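(* Let $\Gamma$ be a strongly connected simple digraph whose adjacency matrix has $d+1$ distinct eigenvalues. Then $\varepsilon_\Gamma\leq\varepsilon_d$, where $\varepsilon_\Gamma$ is the simple excess and $\varepsilon_d$ the spectral excess (defined in the context). Moreover, if $\Gamma$ is a strongly connected normal digraph, then $\varepsilon_\Gamma=\varepsilon_d$ if and only if $\Gamma$ is distance-regular.
   Context: A simple digraph has no loops or multiple arcs (both $(u,v)$ and $(v,u)$ may be arcs); walks, paths and cycles are directed, and "connected" means strongly connected. $\mathbf{A}$ is the adjacency matrix ($\mathbf{A}_{uv}=1$ iff $(u,v)$ is an arc), $n$ the number of vertices; $\Gamma$ is normal if $\mathbf{A}\mathbf{A}^t=\mathbf{A}^t\mathbf{A}$. $\partial(u,v)$ is the directed distance from $u$ to $v$; $\Gamma^+_k(u)=\{v:\partial(u,v)=k\}$; $D$ is the maximum distance. $\delta_k=\frac1n\sum_v|\Gamma^+_k(v)|$ and $\delta'_k=\frac1n\sum_v\delta'_k(v)$, where $\delta'_k(v)$ is the number of paths of length $k$ from $v$ to vertices of $\Gamma^+_k(v)$. The simple excess is $\varepsilon_\Gamma=\delta'^2_d/\delta_d$ if $d\le D$ and $\varepsilon_\Gamma=0$ if $d>D$. Let $\hat D+1$ be the degree of the minimal polynomial of $\mathbf{A}$ (note $d\le\hat D$). For polynomials $\langle f,g\rangle=\frac1n\operatorname{tr}(f(\mathbf{A})g(\mathbf{A})^* )$. The pre-distance polynomials $\mathcal{P}_0,\dots,\mathcal{P}_{\hat D}$ are obtained by Gram–Schmidt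 orthogonalization of $1,x,\dots,x^{\hat D}$ with respect to this inner product ($\mathcal P_i$ monic of degree $i$, mutually orthogonal). The spectral excess is $\varepsilon_d=\langle\mathcal P_d,\mathcal P_d\rangle$. $\Gamma$ is distance-regular if for all vertices $u,v$ with $\partial(u,v)=k$, $1\le k\le D$, the numbers $|\Gamma^+_i(u)\cap\Gamma^+_1(v)|$ for $0\le i\le k+1$ depend only on $k$. *)

theory Defs
  imports
    "Graph_Theory.Graph_Theory"
    "Jordan_Normal_Form.Schur_Decomposition"
    "Jordan_Normal_Form.Spectral_Radius"
begin

section \<open>Digraphs\<close>

text \<open>Simple digraphs are the instances of the locale \<^locale>\<open>digraph\<close> (finite, no loops, no
  parallel arcs), and ``connected'' is \<^const>\<open>strongly_connected\<close>, which includes nonemptiness.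
  \<^term>\<open>pre_digraph.awalk G u p v\<close> and \<^term>\<open>pre_digraph.apath G u p v\<close> say that
  the arc list p is a directed walk, respectively path, from u to v.\<close>

definition ddist :: "('a, 'b) pre_digraph \<Rightarrow> 'a \<Rightarrow> 'a \<Rightarrow> nat" where
  "ddist G u v = (LEAST k. \<exists>p. pre_digraph.awalk G u p v \<and> length p = k)"

text \<open>In strongly connected digraphs the \<open>LEAST\<close> is always attained, and \<^const>\<open>ddist\<close> is the
  library's shortest-path distance for unit weights.\<close>

lemma (in fin_digraph) \<mu>_unit_eq_ddist:
  assumes "u \<rightarrow>\<^sup>* v"
  shows "\<mu> (\<lambda>_. 1) u v = ereal (real (ddist G u v))"
proof -
  have cost: "awalk_cost (\<lambda>_. 1) p = real (length p)" for p :: "'b list"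
    by (induct p) auto
  have ex: "\<exists>k p. awalk u p v \<and> length p = k"
    using assms by (auto simp: reachable_awalk)
  obtain p where p: "awalk u p v" "length p = ddist G u v"
    using LeastI_ex[OF ex] unfolding ddist_def by blast
  have le: "ddist G u v \<le> length q" if "awalk u q v" for q
    unfolding ddist_def by (rule Least_le) (use that in blast)
  show ?thesis
    unfolding \<mu>_def cost
  proof (rule antisym)
    show "(INF p\<in>{p. awalk u p v}. ereal (real (length p))) \<le> ereal (real (ddist G u v))"
      using p by (intro INF_lower2[of p]) auto
    show "ereal (real (ddist G u v)) \<le> (INF p\<in>{p. awalk u p v}. ereal (real (length p)))"
      using le by (intro INF_greatest) auto
  qed
qed

definition out_sphere :: "('a, 'b) pre_digraph \<Rightarrow> nat \<Rightarrow> 'a \<Rightarrow> 'a set" where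
  "out_sphere G k u = {v \<in> verts G. ddist G u v = k}"

definition diam :: "('a, 'b) pre_digraph \<Rightarrow> nat" where
  "diam G = Max {ddist G u v | u v. u \<in> verts G \<and> v \<in> verts G}"

definition mean_sphere :: "('a, 'b) pre_digraph \<Rightarrow> nat \<Rightarrow> real" where
  "mean_sphere G k =
     (\<Sum>v\<in>verts G. real (card (out_sphere G k v))) / real (card (verts G))"

definition num_paths_to_sphere :: "('a, 'b) pre_digraph \<Rightarrow> nat \<Rightarrow> 'a \<Rightarrow> nat" where
  "num_paths_to_sphere G k v =
     card {p. length p = k \<and> (\<exists>w\<in>out_sphere G k v. pre_digraph.apath G v p w)}"

definition mean_paths :: "('a, 'b) pre_digraph \<Rightarrow> nat \<Rightarrow> real" where
  "mean_paths G k =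
     (\<Sum>v\<in>verts G. real (num_paths_to_sphere G k v)) / real (card (verts G))"

definition simple_excess :: "('a, 'b) pre_digraph \<Rightarrow> nat \<Rightarrow> real" where
  "simple_excess G d =
     (if d \<le> diam G then (mean_paths G d)\<^sup>2 / mean_sphere G d else 0)"

definition distance_regular :: "('a, 'b) pre_digraph \<Rightarrow> bool" where
  "distance_regular G \<longleftrightarrow>
     (\<exists>a :: nat \<Rightarrow> nat \<Rightarrow> nat. \<forall>k\<in>{1..diam G}. \<forall>u\<in>verts G. \<forall>v\<in>verts G. ddist G u v = k \<longrightarrow>
        (\<forall>i\<le>k + 1. card (out_sphere G i u \<inter> out_sphere G 1 v) = a i k))"

section \<open>Adjacency matrix and pre-distance polynomials\<close>

text \<open>The list \<open>vs\<close> enumerates the vertices without repetition; row and column i belong to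
  \<open>vs ! i\<close>.\<close>

definition adjacency_mat :: "('a, 'b) pre_digraph \<Rightarrow> 'a list \<Rightarrow> complex mat" where
  "adjacency_mat G vs = mat (length vs) (length vs) (\<lambda>(i, j). if vs ! i \<rightarrow>\<^bsub>G\<^esub> vs ! j then 1 else 0)"

definition normal_mat :: "complex mat \<Rightarrow> bool" where
  "normal_mat A \<longleftrightarrow> A * transpose_mat A = transpose_mat A * A"

definition mat_trace :: "'a :: comm_monoid_add mat \<Rightarrow> 'a" where
  "mat_trace A = (\<Sum>i<dim_row A. A $$ (i, i))"

definition poly_mat :: "complex poly \<Rightarrow> complex mat \<Rightarrow> complex mat" where
  "poly_mat p A =
     mat (dim_row A) (dim_row A) (\<lambda>(i, j). \<Sum>k\<le>degree p. coeff p k * (A ^\<^sub>m k) $$ (i, j))"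

definition poly_inner :: "complex mat \<Rightarrow> complex poly \<Rightarrow> complex poly \<Rightarrow> complex" where
  "poly_inner A f g =
     mat_trace (poly_mat f A * mat_adjoint (poly_mat g A)) / of_nat (dim_row A)"

definition min_poly_degree :: "complex mat \<Rightarrow> nat" where
  "min_poly_degree A =
     (LEAST m. \<exists>p. p \<noteq> 0 \<and> degree p = m \<and> poly_mat p A = 0\<^sub>m (dim_row A) (dim_row A))"

text \<open>Gram-Schmidt without normalisation, applied to \<open>1, x, x\<^sup>2, \<dots>\<close>.  The form \<^const>\<open>poly_inner\<close>
  is positive definite only on polynomials of degree less than \<^const>\<open>min_poly_degree\<close>, so the
  values of the recursion at larger indices are meaningless.  If A has d + 1 distinct eigenvalues
  then d is within range, since every eigenvalue is a root of the minimal polynomial.\<close>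

fun predist :: "complex mat \<Rightarrow> nat \<Rightarrow> complex poly" where
  "predist A k = monom 1 k -
     (\<Sum>i<k. Polynomial.smult (poly_inner A (monom 1 k) (predist A i) /
                   poly_inner A (predist A i) (predist A i)) (predist A i))"

declare predist.simps [simp del]

text \<open>A value \<open>poly_inner A f f\<close> is a real number, so taking the real part loses nothing.\<close>

definition spectral_excess :: "complex mat \<Rightarrow> nat \<Rightarrow> real" where
  "spectral_excess A d = Re (poly_inner A (predist A d) (predist A d))"

subsection \<open>Basic properties of the pre-distance polynomials\<close>

lemma predist_degree: "degree (predist A k) = k"
  and predist_monic: "lead_coeff (predist A k) = 1"
proof -
  have "degree (predist A k) = k \<and> lead_coeff (predist A k) = 1"
  proof (induction k rule: less_induct)
    case (less k)
    define q where "q = (\<Sum>i<k. Polynomial.smult (poly_inner A (monom 1 k) (predist A i) /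
                   poly_inner A (predist A i) (predist A i)) (predist A i))"
    have eq: "predist A k = monom 1 k - q"
      unfolding q_def by (rule predist.simps)
    have c: "coeff q j = 0" if "j \<ge> k" for j
      unfolding q_def coeff_sum
      by (intro sum.neutral) (use that less.IH in \<open>auto intro!: coeff_eq_0\<close>)
    have ck: "coeff (predist A k) k = 1"
      unfolding eq using c[of k] by simp
    have "degree (predist A k) \<le> k"
      unfolding eq using c by (intro degree_le) auto
    with ck have "degree (predist A k) = k"
      by (metis le_antisym le_degree zero_neq_one)
    with ck show ?case by simp
  qed
  then show "degree (predist A k) = k" "lead_coeff (predist A k) = 1" by auto
qed

lemma poly_mat_dims [simp]:
  "dim_row (poly_mat p A) = dim_row A" "dim_col (poly_mat p A) = dim_row A"
  by (simp_all add: poly_mat_def)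

lemma poly_mat_index:
  assumes "i < dim_row A" "j < dim_row A" "degree p \<le> N"
  shows "poly_mat p A $$ (i, j) = (\<Sum>k\<le>N. coeff p k * (A ^\<^sub>m k) $$ (i, j))"
  using assms unfolding poly_mat_def
  by (auto intro!: sum.mono_neutral_left intro: le_degree)

lemma poly_mat_add:
  assumes "i < dim_row A" "j < dim_row A"
  shows "poly_mat (p + q) A $$ (i, j) = poly_mat p A $$ (i, j) + poly_mat q A $$ (i, j)"
proof -
  define N where "N = max (degree p) (degree q)"
  have "degree (p + q) \<le> N" "degree p \<le> N" "degree q \<le> N"
    by (auto simp: N_def degree_add_le_max)
  then show ?thesis
    using assms by (simp add: poly_mat_index algebra_simps sum.distrib)
qed

lemma poly_mat_smult:
  assumes "i < dim_row A" "j < dim_row A"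
  shows "poly_mat (Polynomial.smult c p) A $$ (i, j) = c * poly_mat p A $$ (i, j)"
  using assms
  by (simp add: poly_mat_index[where N = "degree p"] sum_distrib_left mult.assoc)

lemma poly_inner_conv:
  "poly_inner A f g =
     (\<Sum>i<dim_row A. \<Sum>j<dim_row A. poly_mat f A $$ (i, j) * cnj (poly_mat g A $$ (i, j)))
       / of_nat (dim_row A)"
proof -
  have "mat_trace (poly_mat f A * mat_adjoint (poly_mat g A)) =
     (\<Sum>i<dim_row A. \<Sum>j<dim_row A. poly_mat f A $$ (i, j) * cnj (poly_mat g A $$ (i, j)))"
    unfolding mat_trace_def mat_adjoint_def
    by (auto intro!: sum.cong simp: scalar_prod_def atLeast0LessThan mat_of_rows_index)
  then show ?thesis by (simp add: poly_inner_def)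
qed

lemma poly_inner_add: "poly_inner A (p + q) g = poly_inner A p g + poly_inner A q g"
  by (simp add: poly_inner_conv poly_mat_add algebra_simps sum.distrib add_divide_distrib)

lemma poly_inner_smult: "poly_inner A (Polynomial.smult c p) g = c * poly_inner A p g"
  by (simp add: poly_inner_conv poly_mat_smult sum_distrib_left mult.assoc)

lemma poly_inner_diff: "poly_inner A (p - q) g = poly_inner A p g - poly_inner A q g"
  using poly_inner_add[of A "p - q" q g] by simp

lemma poly_inner_sum: "poly_inner A (\<Sum>i\<in>I. f i) g = (\<Sum>i\<in>I. poly_inner A (f i) g)"
proof (induction I rule: infinite_finite_induct)
  case (insert x F)
  then show ?case by (simp add: poly_inner_add)
qed (use poly_inner_smult[of A 0 0 g] in auto)

lemma poly_inner_commute: "poly_inner A g f = cnj (poly_inner A f g)"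
  by (simp add: poly_inner_conv mult.commute)

lemma poly_inner_self: "poly_inner A f f = of_real (Re (poly_inner A f f))"
  using poly_inner_commute[of A f f] by (simp add: complex_eq_iff)

lemma poly_inner_eq_0_imp:
  assumes "poly_inner A f f = 0"
  shows "poly_mat f A = 0\<^sub>m (dim_row A) (dim_row A)"
proof (rule eq_matI)
  fix i j
  assume "i < dim_row (0\<^sub>m (dim_row A) (dim_row A) :: complex mat)"
    and "j < dim_col (0\<^sub>m (dim_row A) (dim_row A) :: complex mat)"
  then have ij: "i < dim_row A" "j < dim_row A" by auto
  let ?e = "\<lambda>i j. (cmod (poly_mat f A $$ (i, j)))\<^sup>2"
  have "complex_of_real (\<Sum>i<dim_row A. \<Sum>j<dim_row A. ?e i j) = 0"
    using assms ij unfolding of_real_sum complex_norm_square poly_inner_conv by auto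
  then have "(\<Sum>i<dim_row A. \<Sum>j<dim_row A. ?e i j) = 0"
    using of_real_eq_0_iff by blast
  then have "?e i j = 0"
    using ij by (simp add: sum_nonneg_eq_0_iff sum_nonneg)
  then show "poly_mat f A $$ (i, j) = 0\<^sub>m (dim_row A) (dim_row A) $$ (i, j)"
    using ij by simp
qed auto

lemma predist_nondegenerate:
  assumes "k < min_poly_degree A"
  shows "poly_inner A (predist A k) (predist A k) \<noteq> 0"
proof
  assume "poly_inner A (predist A k) (predist A k) = 0"
  then have "poly_mat (predist A k) A = 0\<^sub>m (dim_row A) (dim_row A)"
    by (rule poly_inner_eq_0_imp)
  moreover have "predist A k \<noteq> 0"
    using predist_monic[of A k] by auto
  ultimately show False
    using not_less_Least[OF assms[unfolded min_poly_degree_def]] predist_degree by blast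
qed

lemma predist_orthogonal:
  assumes "j < k" "k < min_poly_degree A"
  shows "poly_inner A (predist A k) (predist A j) = 0"
  using assms
proof (induction k arbitrary: j rule: less_induct)
  case (less k)
  have orth: "poly_inner A (predist A i) (predist A j) = 0" if "i < k" "i \<noteq> j" for i
    using that less.IH[of i j] less.IH[of j i] less.prems
      poly_inner_commute[of A "predist A j" "predist A i"]
    by (cases "i < j") auto
  have nz: "poly_inner A (predist A j) (predist A j) \<noteq> 0"
    using less.prems by (intro predist_nondegenerate) auto
  have "(\<Sum>i<k. poly_inner A (monom 1 k) (predist A i) / poly_inner A (predist A i) (predist A i) *
          poly_inner A (predist A i) (predist A j)) =
        (\<Sum>i\<in>{j}. poly_inner A (monom 1 k) (predist A i) / poly_inner A (predist A i) (predist A i) *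
          poly_inner A (predist A i) (predist A j))"
    by (intro sum.mono_neutral_right) (use less.prems orth in auto)
  then show ?case
    by (subst predist.simps) (simp add: poly_inner_diff poly_inner_sum poly_inner_smult nz)
qed

end

theory Submission
  imports Defs
begin

text \<open>
  If \<open>\<partial>(u,v) = d\<close>, the (u,v) entry of \<open>P\<^sub>d(A)\<close> is the number of walks, hence of paths, of length
  d from u to v.  Cauchy-Schwarz for \<open>P\<^sub>d(A)\<close> and the distance-d matrix \<open>A\<^sub>d\<close> therefore gives the
  inequality, with equality only if \<open>P\<^sub>d(A)\<close> is a multiple of \<open>A\<^sub>d\<close>.

  Let A be normal.  Then \<open>A\<^sup>t\<close> is a polynomial in A and the minimal polynomial has degree \<open>d + 1\<close>.
  Given equality, \<open>A\<^sup>t P\<^sub>k\<^sub>+\<^sub>1(A)\<close> is orthogonal to the polynomials of degree less than k, has a nonzero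
  component along \<open>P\<^sub>k\<close>, and vanishes at distances less than k if \<open>P\<^sub>k\<^sub>+\<^sub>1(A)\<close> vanishes at distances
  less than \<open>k + 1\<close>; so by downward induction each \<open>P\<^sub>k(A)\<close> is supported at distance exactly k.  Thus
  polynomials in A have constant diagonal, the digraph is regular, the all-ones matrix is a
  polynomial in A, and expanding it shows that \<open>P\<^sub>k(A)\<close> is a multiple of \<open>A\<^sub>k\<close>.  Then
  \<open>A\<^sub>i A\<^sup>t\<close> is a combination of the \<open>A\<^sub>k\<close>, which is distance-regularity.

  Conversely, distance-regularity says that the span of the \<open>A\<^sub>k\<close> is closed under multiplication by
  \<open>A\<^sup>t\<close>, hence by A, so \<open>P\<^sub>d(A)\<close> is constant on each distance class; orthogonality to
  \<open>1, A, \<dots>, A\<^sup>d\<^sup>-\<^sup>1\<close> kills all classes below d.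
\<close>

subsection \<open>Polynomials in a matrix\<close>

locale square_mat =
  fixes A :: "complex mat" and n :: nat
  assumes A: "A \<in> carrier_mat n n"
begin

lemma dims [simp]: "dim_row A = n" "dim_col A = n"
  using A by auto

lemma pow_carrier [simp]: "A ^\<^sub>m k \<in> carrier_mat n n"
  using A by simp

lemma poly_mat_carrier [simp]: "poly_mat p A \<in> carrier_mat n n"
  by (simp add: carrier_matI)

lemma mult_index:
  assumes "M \<in> carrier_mat n n" "N \<in> carrier_mat n n" "i < n" "j < n"
  shows "(M * N) $$ (i, j) = (\<Sum>l<n. M $$ (i, l) * N $$ (l, j))"
  using assms by (simp add: scalar_prod_def atLeast0LessThan)

lemma pow_Suc_index:
  assumes "i < n" "j < n"
  shows "(A ^\<^sub>m Suc k) $$ (i, j) = (\<Sum>l<n. (A ^\<^sub>m k) $$ (i, l) * A $$ (l, j))"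
  using mult_index[OF pow_carrier A assms] by simp

lemma poly_mat_index':
  assumes "i < n" "j < n" "degree p \<le> N"
  shows "poly_mat p A $$ (i, j) = (\<Sum>k\<le>N. coeff p k * (A ^\<^sub>m k) $$ (i, j))"
  using assms by (simp add: poly_mat_index)

lemma poly_mat_plus: "poly_mat (p + q) A = poly_mat p A + poly_mat q A"
  by (rule eq_matI) (simp_all add: poly_mat_add)

lemma poly_mat_scale: "poly_mat (Polynomial.smult c p) A = c \<cdot>\<^sub>m poly_mat p A"
  by (rule eq_matI) (simp_all add: poly_mat_smult)

lemma poly_mat_zero: "poly_mat 0 A = 0\<^sub>m n n"
  by (rule eq_matI) (simp_all add: poly_mat_def)

lemma poly_mat_diff:
  assumes "i < n" "j < n"
  shows "poly_mat (p - q) A $$ (i, j) = poly_mat p A $$ (i, j) - poly_mat q A $$ (i, j)"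
  using poly_mat_add[of i A j "p - q" q] assms by simp

lemma poly_mat_sum:
  assumes "i < n" "j < n"
  shows "poly_mat (\<Sum>x\<in>S. f x) A $$ (i, j) = (\<Sum>x\<in>S. poly_mat (f x) A $$ (i, j))"
  using assms
  by (induction S rule: infinite_finite_induct) (simp_all add: poly_mat_add poly_mat_zero)

lemma poly_mat_monom: "poly_mat (monom 1 k) A = A ^\<^sub>m k"
proof (rule eq_matI)
  fix i j assume "i < dim_row (A ^\<^sub>m k)" "j < dim_col (A ^\<^sub>m k)"
  then have ij: "i < n" "j < n" using carrier_matD[OF pow_carrier[of k]] by metis+
  then have "poly_mat (monom 1 k) A $$ (i, j) = (\<Sum>l\<le>k. coeff (monom 1 k) l * (A ^\<^sub>m l) $$ (i, j))"
    by (rule poly_mat_index') (simp add: degree_monom_eq)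
  also have "\<dots> = (\<Sum>l\<le>k. if l = k then (A ^\<^sub>m l) $$ (i, j) else 0)"
    by (intro sum.cong) auto
  finally show "poly_mat (monom 1 k) A $$ (i, j) = (A ^\<^sub>m k) $$ (i, j)" by simp
qed (use carrier_matD[OF pow_carrier[of k]] in \<open>simp_all only: poly_mat_dims dims\<close>)

lemma poly_mat_one: "poly_mat 1 A = 1\<^sub>m n"
  using poly_mat_monom[of 0] by simp

lemma poly_mat_X: "poly_mat [:0, 1:] A = A"
  using poly_mat_monom[of 1] A by (simp add: monom_altdef)

lemma poly_mat_shift: "poly_mat (pCons 0 p) A = poly_mat p A * A"
proof (rule eq_matI)
  fix i j assume "i < dim_row (poly_mat p A * A)" "j < dim_col (poly_mat p A * A)"
  then have ij: "i < n" "j < n" by auto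
  have "poly_mat (pCons 0 p) A $$ (i, j)
      = (\<Sum>k\<le>Suc (degree p). coeff (pCons 0 p) k * (A ^\<^sub>m k) $$ (i, j))"
    by (rule poly_mat_index') (use ij in auto)
  also have "\<dots> = (\<Sum>k\<le>degree p. coeff p k * (A ^\<^sub>m Suc k) $$ (i, j))"
    by (subst sum.atMost_Suc_shift) (simp del: pow_mat.simps)
  also have "\<dots> = (\<Sum>k\<le>degree p. \<Sum>l<n. coeff p k * (A ^\<^sub>m k) $$ (i, l) * A $$ (l, j))"
    using ij by (simp only: pow_Suc_index sum_distrib_left mult.assoc)
  also have "\<dots> = (\<Sum>l<n. \<Sum>k\<le>degree p. coeff p k * (A ^\<^sub>m k) $$ (i, l) * A $$ (l, j))"
    by (rule sum.swap)
  also have "\<dots> = (\<Sum>l<n. poly_mat p A $$ (i, l) * A $$ (l, j))"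
    using ij by (simp add: poly_mat_index'[where N = "degree p"] sum_distrib_right)
  also have "\<dots> = (poly_mat p A * A) $$ (i, j)"
    using ij by (subst mult_index) (simp_all add: A)
  finally show "poly_mat (pCons 0 p) A $$ (i, j) = (poly_mat p A * A) $$ (i, j)" .
qed auto

text \<open>Induction on \<open>q\<close> in Horner form: \<open>pCons a q\<close> contributes a
  scalar matrix and one further right factor \<open>A\<close>.\<close>

lemma poly_mat_mult: "poly_mat (p * q) A = poly_mat p A * poly_mat q A"
proof (induction q)
  case 0
  show ?case using A by (simp add: poly_mat_zero right_mult_zero_mat[of _ n n])
next
  case (pCons a q)
  let ?M = "\<lambda>p. poly_mat p A"
  have split: "?M (pCons a r) = a \<cdot>\<^sub>m 1\<^sub>m n + ?M r * A" for r
    using poly_mat_plus[of "[:a:]" "pCons 0 r"] poly_mat_scale[of a 1]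
    by (simp add: poly_mat_one poly_mat_shift)
  have "?M (p * pCons a q) = a \<cdot>\<^sub>m ?M p + (?M p * ?M q) * A"
    using poly_mat_plus[of "Polynomial.smult a p" "pCons 0 (p * q)"]
    by (simp add: poly_mat_scale poly_mat_shift pCons.IH)
  also have "\<dots> = a \<cdot>\<^sub>m (?M p * 1\<^sub>m n) + ?M p * (?M q * A)"
    using A by (simp add: assoc_mult_mat[of _ n n _ n _ n] right_mult_one_mat[of _ n n])
  also have "\<dots> = ?M p * (a \<cdot>\<^sub>m 1\<^sub>m n) + ?M p * (?M q * A)"
    by (simp only: mult_smult_distrib[of _ n n _ n] poly_mat_carrier one_carrier_mat)
  also have "\<dots> = ?M p * (a \<cdot>\<^sub>m 1\<^sub>m n + ?M q * A)"
    using A by (intro mult_add_distrib_mat[of _ n n _ n, symmetric]) auto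
  finally show ?case by (simp add: split)
qed

text \<open>The columns of \<open>X\<close> are zero or eigenvectors for \<open>c\<close>, so powers
  of \<open>A\<close> act on them as powers of \<open>c\<close>. A single vector enters as a matrix
  with \<open>m = 1\<close>.\<close>

lemma poly_mat_eigen:
  assumes "X \<in> carrier_mat n m" "\<And>i j. i < n \<Longrightarrow> j < m \<Longrightarrow> (\<Sum>l<n. A $$ (i, l) * X $$ (l, j)) = c * X $$ (i, j)"
    and "i < n" "j < m"
  shows "(\<Sum>l<n. poly_mat p A $$ (i, l) * X $$ (l, j)) = poly p c * X $$ (i, j)"
proof -
  have pw: "(\<Sum>l<n. (A ^\<^sub>m k) $$ (i, l) * X $$ (l, j)) = c ^ k * X $$ (i, j)" for k
  proof (induction k)
    case 0
    have "(\<Sum>l<n. 1\<^sub>m n $$ (i, l) * X $$ (l, j)) = (\<Sum>l<n. if l = i then X $$ (l, j) else 0)"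
      using assms by (intro sum.cong) auto
    then show ?case using assms by simp
  next
    case (Suc k)
    have "(\<Sum>l<n. (A ^\<^sub>m Suc k) $$ (i, l) * X $$ (l, j))
        = (\<Sum>l<n. \<Sum>h<n. (A ^\<^sub>m k) $$ (i, h) * (A $$ (h, l) * X $$ (l, j)))"
      by (intro sum.cong refl) (simp only: pow_Suc_index[OF assms(3)] sum_distrib_right mult.assoc lessThan_iff)
    also have "\<dots> = (\<Sum>h<n. (A ^\<^sub>m k) $$ (i, h) * (\<Sum>l<n. A $$ (h, l) * X $$ (l, j)))"
      by (subst sum.swap) (simp add: sum_distrib_left)
    also have "\<dots> = (\<Sum>h<n. (A ^\<^sub>m k) $$ (i, h) * (c * X $$ (h, j)))"
      using assms by (intro sum.cong) auto
    also have "\<dots> = c * (\<Sum>h<n. (A ^\<^sub>m k) $$ (i, h) * X $$ (h, j))"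
      by (simp add: sum_distrib_left mult_ac)
    finally show ?case using Suc.IH by simp
  qed
  have "(\<Sum>l<n. poly_mat p A $$ (i, l) * X $$ (l, j))
      = (\<Sum>l<n. \<Sum>k\<le>degree p. coeff p k * ((A ^\<^sub>m k) $$ (i, l) * X $$ (l, j)))"
    using assms by (intro sum.cong) (simp_all add: poly_mat_index'[where N = "degree p"] sum_distrib_right mult.assoc)
  also have "\<dots> = (\<Sum>k\<le>degree p. coeff p k * (c ^ k * X $$ (i, j)))"
    by (subst sum.swap) (simp add: pw flip: sum_distrib_left)
  finally show ?thesis by (simp add: poly_altdef sum_distrib_right mult.assoc)
qed

text \<open>Dimension count: \<open>n * n + 1\<close> powers of \<open>A\<close> in a space of
  dimension \<open>n * n\<close> are linearly dependent.\<close>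

lemma annihilating_poly_exists: "\<exists>p. p \<noteq> 0 \<and> poly_mat p A = 0\<^sub>m n n"
proof -
  define N where "N = n * n"
  \<comment> \<open>Column \<open>k\<close> lists the entries of \<open>A ^\<^sub>m k\<close> row by
    row; the extra zero row \<open>N\<close> makes \<open>M\<close> square and singular. A kernel
    vector holds the coefficients of a dependency.\<close>
  define M where "M = mat (Suc N) (Suc N) (\<lambda>(r, k). if r < N then (A ^\<^sub>m k) $$ (r div n, r mod n) else 0)"
  have M: "M \<in> carrier_mat (Suc N) (Suc N)" by (simp add: M_def)
  have "M = mat\<^sub>r (Suc N) (Suc N) (\<lambda>r. if r = N then 0\<^sub>v (Suc N) else row M r)"
    by (rule eq_matI) (auto simp: M_def less_Suc_eq)
  moreover have "det (mat\<^sub>r (Suc N) (Suc N) (\<lambda>r. if r = N then 0\<^sub>v (Suc N) else row M r)) = 0"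
    by (rule det_row_0) (use M in auto)
  ultimately have "det M = 0" by simp
  then obtain v where v: "v \<in> carrier_vec (Suc N)" "v \<noteq> 0\<^sub>v (Suc N)" "M *\<^sub>v v = 0\<^sub>v (Suc N)"
    using det_0_iff_vec_prod_zero[OF M] by auto
  define p where "p = Abs_poly (\<lambda>k. if k < Suc N then v $ k else 0)"
  have c: "coeff p k = (if k < Suc N then v $ k else 0)" for k
    unfolding p_def by (subst coeff_Abs_poly[where n = N]) auto
  have "p \<noteq> 0"
  proof
    assume "p = 0"
    then have "v $ k = 0" if "k < Suc N" for k using c[of k] that by simp
    then show False using v by (auto intro!: eq_vecI)
  qed
  moreover have "poly_mat p A = 0\<^sub>m n n"
  proof (rule eq_matI)
    fix i j assume "i < dim_row (0\<^sub>m n n :: complex mat)" "j < dim_col (0\<^sub>m n n :: complex mat)"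
    then have ij: "i < n" "j < n" by auto
    define r where "r = i * n + j"
    have "i * n + j < Suc i * n" using ij by simp
    also have "\<dots> \<le> n * n" using ij by (intro mult_right_mono) auto
    finally have r: "r < N" "r div n = i" "r mod n = j" using ij by (auto simp: r_def N_def)
    have "(\<Sum>k<Suc N. M $$ (r, k) * v $ k) = (M *\<^sub>v v) $ r"
      using r v(1) M by (simp add: scalar_prod_def atLeast0LessThan del: sum.lessThan_Suc)
    also have "\<dots> = 0" using v r by simp
    finally have eq: "(\<Sum>k\<le>N. v $ k * (A ^\<^sub>m k) $$ (i, j)) = 0"
      unfolding lessThan_Suc_atMost using r by (simp add: M_def mult.commute del: sum.lessThan_Suc)
    have "degree p \<le> N" by (rule degree_le) (auto simp: c)
    then have "poly_mat p A $$ (i, j) = (\<Sum>k\<le>N. coeff p k * (A ^\<^sub>m k) $$ (i, j))"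
      using ij by (intro poly_mat_index')
    also have "\<dots> = (\<Sum>k\<le>N. v $ k * (A ^\<^sub>m k) $$ (i, j))"
      by (intro sum.cong) (auto simp: c)
    finally show "poly_mat p A $$ (i, j) = 0\<^sub>m n n $$ (i, j)"
      using ij eq by simp
  qed auto
  ultimately show ?thesis by blast
qed

end

subsection \<open>Real normal matrices\<close>

text \<open>The Frobenius inner product; \<open>poly_inner\<close> is its restriction to polynomials
  in \<open>A\<close>, divided by \<open>n\<close>.\<close>

definition frob :: "nat \<Rightarrow> complex mat \<Rightarrow> complex mat \<Rightarrow> complex" where
  "frob n M N = (\<Sum>i<n. \<Sum>j<n. M $$ (i, j) * cnj (N $$ (i, j)))"

lemma frob_conv_norm: "frob n M M = of_real (\<Sum>i<n. \<Sum>j<n. (cmod (M $$ (i, j)))\<^sup>2)"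
  by (simp only: frob_def of_real_sum complex_norm_square)

lemma frob_eq_0D:
  assumes "frob n M M = 0" "i < n" "j < n"
  shows "M $$ (i, j) = 0"
proof -
  have "(\<Sum>i<n. \<Sum>j<n. (cmod (M $$ (i, j)))\<^sup>2) = 0"
    using assms(1) unfolding frob_conv_norm by (simp only: of_real_eq_0_iff)
  then show ?thesis using assms(2,3) by (simp add: sum_nonneg_eq_0_iff sum_nonneg)
qed

lemma frob_smult_left: "M \<in> carrier_mat n n \<Longrightarrow> frob n (c \<cdot>\<^sub>m M) N = c * frob n M N"
  by (simp add: frob_def sum_distrib_left mult.assoc)

lemma frob_smult_right: "N \<in> carrier_mat n n \<Longrightarrow> frob n M (c \<cdot>\<^sub>m N) = cnj c * frob n M N"
  by (simp add: frob_def sum_distrib_left mult_ac)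

lemma frob_minus_left:
  "M \<in> carrier_mat n n \<Longrightarrow> N \<in> carrier_mat n n \<Longrightarrow> frob n (M - N) R = frob n M R - frob n N R"
  by (simp add: frob_def algebra_simps sum_subtractf)

lemma frob_minus_right:
  "M \<in> carrier_mat n n \<Longrightarrow> N \<in> carrier_mat n n \<Longrightarrow> frob n R (M - N) = frob n R M - frob n R N"
  by (simp add: frob_def algebra_simps sum_subtractf)

text \<open>\<open>normal_mat\<close> speaks of the transpose; real entries make the transpose the
  adjoint of \<open>A\<close> for \<open>frob\<close>.\<close>

locale normal_real_mat = square_mat +
  assumes real_entries: "\<And>i j. i < n \<Longrightarrow> j < n \<Longrightarrow> cnj (A $$ (i, j)) = A $$ (i, j)"
    and normal: "normal_mat A"
begin

abbreviation "T \<equiv> transpose_mat A"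

lemma T [simp]: "T \<in> carrier_mat n n" by (simp add: A)

lemma frob_mult:
  assumes M: "M \<in> carrier_mat n n" and N: "N \<in> carrier_mat n n"
  shows "frob n (A * M) N = frob n M (T * N)"
proof -
  have "frob n (A * M) N = (\<Sum>i<n. \<Sum>j<n. \<Sum>l<n. A $$ (i, l) * M $$ (l, j) * cnj (N $$ (i, j)))"
    unfolding frob_def using M by (intro sum.cong refl) (simp only: mult_index[OF A] sum_distrib_right lessThan_iff)
  also have "\<dots> = (\<Sum>i<n. \<Sum>l<n. \<Sum>j<n. A $$ (i, l) * M $$ (l, j) * cnj (N $$ (i, j)))"
    by (intro sum.cong refl sum.swap)
  also have "\<dots> = (\<Sum>l<n. \<Sum>i<n. \<Sum>j<n. A $$ (i, l) * M $$ (l, j) * cnj (N $$ (i, j)))"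
    by (rule sum.swap)
  also have "\<dots> = (\<Sum>l<n. \<Sum>j<n. \<Sum>i<n. A $$ (i, l) * M $$ (l, j) * cnj (N $$ (i, j)))"
    by (intro sum.cong refl sum.swap)
  also have "\<dots> = (\<Sum>l<n. \<Sum>j<n. \<Sum>i<n. M $$ (l, j) * cnj (T $$ (l, i) * N $$ (i, j)))"
    by (intro sum.cong refl) (simp add: real_entries)
  also have "\<dots> = frob n M (T * N)"
    unfolding frob_def using N
    by (intro sum.cong refl) (simp only: mult_index[OF T] sum_distrib_left cnj_sum lessThan_iff)
  finally show ?thesis .
qed

lemma normal_real_mat_transpose: "normal_real_mat T n"
  by unfold_locales (use normal real_entries A in \<open>auto simp: normal_mat_def\<close>)

lemma frob_mult_transpose:
  assumes "M \<in> carrier_mat n n" "N \<in> carrier_mat n n"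
  shows "frob n (T * M) N = frob n M (A * N)"
  using normal_real_mat.frob_mult[OF normal_real_mat_transpose assms] by simp

text \<open>By normality \<open>T * X\<close> satisfies the same eigenvalue equation as
  \<open>X\<close>. Hence the four terms in the expansion of \<open>frob n Y Y\<close> all equal
  \<open>c * cnj c * s\<close> up to sign, and they cancel.\<close>

lemma transpose_eigen:
  assumes X: "X \<in> carrier_mat n n" and eq: "A * X = c \<cdot>\<^sub>m X"
  shows "T * X = cnj c \<cdot>\<^sub>m X"
proof -
  define Y where "Y = T * X - cnj c \<cdot>\<^sub>m X"
  have TX: "T * X \<in> carrier_mat n n" and cX: "cnj c \<cdot>\<^sub>m X \<in> carrier_mat n n"
    using X T by auto
  define s where "s = frob n X X"
  have 1: "frob n (T * X) X = cnj c * s"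
    by (simp add: frob_mult_transpose X eq frob_smult_right s_def)
  have 2: "frob n X (T * X) = c * s"
    by (simp add: X eq frob_smult_left s_def flip: frob_mult)
  have "A * (T * X) = T * (A * X)"
    using normal assoc_mult_mat[OF A T X] assoc_mult_mat[OF T A X] by (simp add: normal_mat_def)
  also have "\<dots> = c \<cdot>\<^sub>m (T * X)"
    unfolding eq by (rule mult_smult_distrib[OF T X])
  finally have "A * (T * X) = c \<cdot>\<^sub>m (T * X)" .
  then have 3: "frob n (T * X) (T * X) = c * cnj c * s"
    using frob_mult[OF TX X] by (simp add: frob_smult_left TX 1 mult.assoc)
  have "frob n Y Y = 0"
    unfolding Y_def using TX cX X
    by (simp add: frob_minus_left frob_minus_right frob_smult_left frob_smult_right 1 2 3 flip: s_def)
  then have "Y $$ (i, j) = 0" if "i < n" "j < n" for i j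
    using frob_eq_0D that by blast
  then show ?thesis using X A unfolding Y_def by (intro eq_matI) auto
qed

lemma mult_linear_eq:
  "poly_mat ([:- c, 1:] * r) A = A * poly_mat r A - c \<cdot>\<^sub>m poly_mat r A"
proof -
  have eq: "[:- c, 1:] * r = [:0, 1:] * r - Polynomial.smult c r" by simp
  show ?thesis
    unfolding eq by (rule eq_matI) (simp_all add: poly_mat_diff poly_mat_smult poly_mat_mult poly_mat_X del: mult_pCons_left)
qed

text \<open>Turns a linear factor of an annihilating polynomial into an eigenvector equation for the
  columns of the cofactor evaluated at \<open>A\<close>.\<close>

lemma linear_factor_annihilates_iff:
  "poly_mat ([:- c, 1:] * r) A = 0\<^sub>m n n \<longleftrightarrow> A * poly_mat r A = c \<cdot>\<^sub>m poly_mat r A"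
proof -
  have "(\<forall>i j. i < n \<longrightarrow> j < n \<longrightarrow> (A * poly_mat r A) $$ (i, j) - (c \<cdot>\<^sub>m poly_mat r A) $$ (i, j) = 0)
    \<longleftrightarrow> (\<forall>i j. i < n \<longrightarrow> j < n \<longrightarrow> (A * poly_mat r A) $$ (i, j) = (c \<cdot>\<^sub>m poly_mat r A) $$ (i, j))"
    by (simp only: right_minus_eq)
  then show ?thesis
    unfolding mult_linear_eq mat_eq_iff[where x = "_ * _"] mat_eq_iff[where x = "_ - _"] 
    by (simp del: index_mult_mat(1) index_smult_mat(1))
qed

text \<open>Nontrivial Jordan blocks are excluded: \<open>Y = (A - c) X\<close> is killed by
  \<open>A - c\<close>, hence also by its adjoint, and moving \<open>A - c\<close> across the inner
  product gives \<open>frob n Y Y = 0\<close>.\<close>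

lemma semisimple:
  assumes "poly_mat ([:- c, 1:] * ([:- c, 1:] * r)) A = 0\<^sub>m n n"
  shows "poly_mat ([:- c, 1:] * r) A = 0\<^sub>m n n"
proof -
  define X where "X = poly_mat r A"
  define Y where "Y = poly_mat ([:- c, 1:] * r) A"
  have X: "X \<in> carrier_mat n n" and Y: "Y \<in> carrier_mat n n" by (simp_all add: X_def Y_def del: mult_pCons_left)
  have TY: "T * Y = cnj c \<cdot>\<^sub>m Y"
    using assms Y unfolding linear_factor_annihilates_iff Y_def[symmetric] by (intro transpose_eigen)
  have YX: "Y = A * X - c \<cdot>\<^sub>m X"
    unfolding X_def Y_def by (rule mult_linear_eq)
  have "frob n Y Y = frob n (A * X) Y - c * frob n X Y"
    using X A by (subst (1) YX) (simp add: frob_minus_left frob_smult_left mult_carrier_mat[of A n n])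
  also have "\<dots> = 0"
    using X Y by (simp add: frob_mult TY frob_smult_right)
  finally have "Y $$ (i, j) = 0" if "i < n" "j < n" for i j
    using frob_eq_0D that by blast
  then show ?thesis
    using Y unfolding Y_def[symmetric] by (intro eq_matI) auto
qed

end

section \<open>Eigenvalues as roots of annihilating polynomials\<close>

context square_mat
begin

text \<open>An eigenvector \<open>v\<close> satisfies \<open>p(A) v = p(c) v\<close>, and here the
  left side is zero.\<close>

lemma eigenvalue_imp_root:
  assumes "poly_mat p A = 0\<^sub>m n n" "eigenvalue A c"
  shows "poly p c = 0"
proof -
  obtain v where v: "v \<in> carrier_vec n" "v \<noteq> 0\<^sub>v n" "A *\<^sub>v v = c \<cdot>\<^sub>v v"
    using assms(2) unfolding eigenvalue_def eigenvector_def by auto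
  obtain i where i: "i < n" "v $ i \<noteq> 0"
    using v by (auto simp: vec_eq_iff)
  define X where "X = mat n 1 (\<lambda>(i, j). v $ i)"
  have "(\<Sum>l<n. A $$ (i, l) * X $$ (l, j)) = c * X $$ (i, j)" if "i < n" "j < 1" for i j
  proof -
    have "(\<Sum>l<n. A $$ (i, l) * v $ l) = (A *\<^sub>v v) $ i"
      using that v(1) A by (simp add: scalar_prod_def atLeast0LessThan)
    then show ?thesis using that v by (simp add: X_def)
  qed
  then have "(\<Sum>l<n. poly_mat p A $$ (i, l) * X $$ (l, 0)) = poly p c * X $$ (i, 0)"
    using i by (intro poly_mat_eigen[where m = 1]) (auto simp: X_def)
  moreover have "(\<Sum>l<n. poly_mat p A $$ (i, l) * X $$ (l, 0)) = 0"
    using i by (intro sum.neutral) (simp add: assms(1))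
  ultimately show ?thesis using i by (simp add: X_def)
qed

lemma card_spectrum_le_degree:
  assumes "p \<noteq> 0" "poly_mat p A = 0\<^sub>m n n"
  shows "card (spectrum A) \<le> degree p"
proof -
  have "card (spectrum A) \<le> card {c. poly p c = 0}"
    using eigenvalue_imp_root[OF assms(2)] assms(1)
    by (intro card_mono poly_roots_finite) (auto simp: spectrum_def)
  also have "\<dots> \<le> degree p" using assms by (intro card_poly_roots_bound)
  finally show ?thesis .
qed

lemma min_poly_exists:
  obtains m where "m \<noteq> 0" "poly_mat m A = 0\<^sub>m n n" "degree m = min_poly_degree A"
    and "\<And>p. p \<noteq> 0 \<Longrightarrow> poly_mat p A = 0\<^sub>m n n \<Longrightarrow> degree m \<le> degree p"
proof -
  let ?P = "\<lambda>k. \<exists>p. p \<noteq> 0 \<and> degree p = k \<and> poly_mat p A = 0\<^sub>m n n"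
  have md: "min_poly_degree A = Least ?P" by (simp add: min_poly_degree_def)
  have "?P (min_poly_degree A)"
    unfolding md by (rule LeastI_ex) (use annihilating_poly_exists in blast)
  moreover have "min_poly_degree A \<le> degree p" if "p \<noteq> 0" "poly_mat p A = 0\<^sub>m n n" for p
    unfolding md by (rule Least_le) (use that in blast)
  ultimately show thesis using that by metis
qed

end

text \<open>Lagrange interpolation of the constant 1: both sides have degree below
  \<open>card S\<close> and agree on \<open>S\<close>.\<close>

lemma lagrange_basis_sum:
  fixes S :: "'a::field set"
  assumes "finite S" "S \<noteq> {}"
  shows "(\<Sum>c\<in>S. Polynomial.smult (inverse (\<Prod>b\<in>S - {c}. c - b)) (\<Prod>b\<in>S - {c}. [:- b, 1:])) = 1"
    (is "?p = 1")
proof (rule poly_eqI_degree[where A = S])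
  fix x assume x: "x \<in> S"
  have "poly ?p x = (\<Sum>c\<in>S. if c = x then 1 else 0)"
    unfolding poly_sum
  proof (intro sum.cong refl)
    fix c assume c: "c \<in> S"
    show "poly (Polynomial.smult (inverse (\<Prod>b\<in>S - {c}. c - b)) (\<Prod>b\<in>S - {c}. [:- b, 1:])) x
        = (if c = x then 1 else 0)"
    proof (cases "c = x")
      case True
      then show ?thesis using assms(1) by (simp add: poly_prod)
    next
      case False
      then have "(\<Prod>b\<in>S - {c}. x - b) = 0" using x assms(1) by auto
      then show ?thesis using False by (simp add: poly_prod)
    qed
  qed
  then show "poly ?p x = poly 1 x" using x assms(1) by simp
next
  have "degree ?p \<le> card S - 1"
  proof (rule degree_sum_le[OF assms(1)])
    fix c assume "c \<in> S"
    then show "degree (Polynomial.smult (inverse (\<Prod>b\<in>S - {c}. c - b)) (\<Prod>b\<in>S - {c}. [:- b, 1:])) \<le> card S - 1"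
      using assms(1) by (intro order.trans[OF degree_smult_le]) (simp add: degree_prod_sum_eq)
  qed
  moreover have "card S > 0" using assms by (simp add: card_gt_0_iff)
  ultimately show "card S > degree ?p" by linarith
  show "card S > degree (1 :: 'a poly)" using assms by (simp add: card_gt_0_iff)
qed

context square_mat
begin

lemma finite_spectrum: "finite (spectrum A)"
proof -
  obtain p where p: "p \<noteq> 0" "poly_mat p A = 0\<^sub>m n n" using annihilating_poly_exists by blast
  then have "spectrum A \<subseteq> {c. poly p c = 0}" using eigenvalue_imp_root by (auto simp: spectrum_def)
  then show ?thesis using poly_roots_finite[OF p(1)] finite_subset by blast
qed

lemma card_spectrum_le_min_poly_degree: "card (spectrum A) \<le> min_poly_degree A"
  by (metis card_spectrum_le_degree min_poly_exists)

end

section \<open>Diagonalisability of normal matrices and the transpose as a polynomial\<close>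

context normal_real_mat
begin

text \<open>The minimal polynomial of a normal matrix is squarefree with exactly the eigenvalues as
  roots, hence a scalar multiple of this product.\<close>

lemma poly_mat_prod_spectrum: "poly_mat (\<Prod>c\<in>spectrum A. [:- c, 1:]) A = 0\<^sub>m n n"
proof -
  obtain m where m: "m \<noteq> 0" "poly_mat m A = 0\<^sub>m n n"
    and min: "\<And>p. p \<noteq> 0 \<Longrightarrow> poly_mat p A = 0\<^sub>m n n \<Longrightarrow> degree m \<le> degree p"
    by (rule min_poly_exists) blast
  have cofactor: "poly_mat r A \<noteq> 0\<^sub>m n n" if "m = [:- c, 1:] * r" for c r
  proof
    assume "poly_mat r A = 0\<^sub>m n n"
    moreover have "r \<noteq> 0" using that m by auto
    ultimately have "degree m \<le> degree r" by (intro min)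
    moreover have "degree m = Suc (degree r)"
      unfolding that using \<open>r \<noteq> 0\<close> by (subst degree_mult_eq) auto
    ultimately show False by simp
  qed
  \<comment> \<open>Dividing \<open>m\<close> by the factor of a root leaves a cofactor that is
    nonzero at \<open>A\<close>; any nonzero column of it is an eigenvector.\<close>
  have "eigenvalue A c" if "poly m c = 0" for c
  proof -
    obtain r where r: "m = [:- c, 1:] * r" using \<open>poly m c = 0\<close> by (auto simp: poly_eq_0_iff_dvd elim: dvdE)
    define X where "X = poly_mat r A"
    have X: "X \<in> carrier_mat n n" by (simp add: X_def)
    have AX: "A * X = c \<cdot>\<^sub>m X"
      using m(2) unfolding r X_def linear_factor_annihilates_iff .
    have "X \<noteq> 0\<^sub>m n n" using cofactor[OF r] by (simp add: X_def)
    then obtain i j where ij: "i < n" "j < n" "X $$ (i, j) \<noteq> 0"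
      using X by (auto simp: mat_eq_iff)
    have "A *\<^sub>v col X j = col (A * X) j" using col_mult2[OF A X ij(2)] by simp
    also have "\<dots> = c \<cdot>\<^sub>v col X j" unfolding AX using X ij by (intro eq_vecI) auto
    finally have "A *\<^sub>v col X j = c \<cdot>\<^sub>v col X j" .
    moreover have "col X j \<noteq> 0\<^sub>v n" using ij X by (metis carrier_matD index_col index_zero_vec(1))
    moreover have "col X j \<in> carrier_vec n" using X by auto
    ultimately show ?thesis unfolding eigenvalue_def eigenvector_def by auto
  qed
  then have roots: "{c. poly m c = 0} = spectrum A"
    using eigenvalue_imp_root[OF m(2)] by (auto simp: spectrum_def)
  \<comment> \<open>At a multiple root \<open>semisimple\<close> would remove one factor, against
    the minimality of \<open>m\<close>.\<close>
  have "order a m \<le> 1" for a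
  proof (rule ccontr)
    assume "\<not> order a m \<le> 1"
    then have "[:- a, 1:] ^ 2 dvd m" by (subst order_divides) auto
    then obtain r where "m = [:- a, 1:] ^ 2 * r" by (elim dvdE)
    then have r: "m = [:- a, 1:] * ([:- a, 1:] * r)" by (simp only: power2_eq_square mult.assoc)
    show False using cofactor[OF r] m(2) unfolding r by (blast dest: semisimple)
  qed
  then have "rsquarefree m" using m(1) by (auto simp: rsquarefree_def le_Suc_eq)
  then have "Polynomial.smult (lead_coeff m) (\<Prod>c\<in>spectrum A. [:- c, 1:]) = m"
    using complex_poly_decompose_rsquarefree[of m] by (simp add: roots)
  then have "(\<Prod>c\<in>spectrum A. [:- c, 1:]) = Polynomial.smult (inverse (lead_coeff m)) m"
    using m(1) by (metis leading_coeff_0_iff left_inverse smult_1_left smult_smult)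
  then show ?thesis using m(2) by (simp add: poly_mat_scale mat_eq_iff)
qed

lemma min_poly_degree_normal: "min_poly_degree A = card (spectrum A)"
proof (rule antisym)
  show "card (spectrum A) \<le> min_poly_degree A" by (rule card_spectrum_le_min_poly_degree)
  have "degree (\<Prod>c\<in>spectrum A. [:- c, 1:]) = card (spectrum A)"
    by (simp add: degree_prod_sum_eq)
  moreover have "(\<Prod>c\<in>spectrum A. [:- c, 1:]) \<noteq> 0" by (simp add: finite_spectrum)
  ultimately show "min_poly_degree A \<le> card (spectrum A)"
    unfolding min_poly_degree_def using poly_mat_prod_spectrum by (intro Least_le) auto
qed

text \<open>\<open>q\<close> interpolates complex conjugation on the spectrum: the matrices
  \<open>w c * L c (A)\<close> sum to the identity, and \<open>T\<close> acts on each as the scalar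
  \<open>cnj c\<close>.\<close>

lemma transpose_eq_poly_mat:
  assumes "spectrum A \<noteq> {}"
  obtains q where "poly_mat q A = T"
proof
  define S where "S = spectrum A"
  define L where "L c = (\<Prod>b\<in>S - {c}. [:- b, 1:])" for c :: complex
  define w where "w c = inverse (\<Prod>b\<in>S - {c}. c - b)" for c
  define q where "q = (\<Sum>c\<in>S. Polynomial.smult (w c * cnj c) (L c))"
  have one: "(\<Sum>c\<in>S. Polynomial.smult (w c) (L c)) = 1"
    unfolding w_def L_def S_def using finite_spectrum assms by (rule lagrange_basis_sum)
  have TL: "T * poly_mat (L c) A = cnj c \<cdot>\<^sub>m poly_mat (L c) A" if "c \<in> S" for c
  proof -
    have "[:- c, 1:] * L c = (\<Prod>c\<in>S. [:- c, 1:])"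
      using that finite_spectrum by (simp only: L_def S_def prod.remove)
    then show ?thesis
      using poly_mat_prod_spectrum linear_factor_annihilates_iff[of c "L c"]
      by (intro transpose_eigen) (simp_all add: S_def)
  qed
  show "poly_mat q A = T"
  proof (rule eq_matI)
    fix i j assume "i < dim_row T" "j < dim_col T"
    then have ij: "i < n" "j < n" by auto
    have "T $$ (i, j) = (T * poly_mat 1 A) $$ (i, j)"
      using T by (simp add: poly_mat_one)
    also have "\<dots> = (\<Sum>l<n. T $$ (i, l) * poly_mat (\<Sum>c\<in>S. Polynomial.smult (w c) (L c)) A $$ (l, j))"
      unfolding one using ij by (intro mult_index) auto
    also have "\<dots> = (\<Sum>l<n. \<Sum>c\<in>S. w c * (T $$ (i, l) * poly_mat (L c) A $$ (l, j)))"
      using ij by (intro sum.cong) (simp_all add: poly_mat_sum poly_mat_smult sum_distrib_left mult_ac)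
    also have "\<dots> = (\<Sum>c\<in>S. w c * (\<Sum>l<n. T $$ (i, l) * poly_mat (L c) A $$ (l, j)))"
      by (subst sum.swap) (simp add: sum_distrib_left)
    also have "\<dots> = (\<Sum>c\<in>S. w c * (T * poly_mat (L c) A) $$ (i, j))"
      by (simp only: mult_index[OF T poly_mat_carrier ij])
    also have "\<dots> = poly_mat q A $$ (i, j)"
      using ij by (simp add: TL q_def poly_mat_sum poly_mat_smult mult.assoc)
    finally show "poly_mat q A $$ (i, j) = T $$ (i, j)" by simp
  qed (use A in auto)
qed

end

subsection \<open>Orthogonality to polynomials of small degree\<close>

context square_mat
begin

lemma poly_inner_frob: "poly_inner A f g = frob n (poly_mat f A) (poly_mat g A) / of_nat n"
  by (simp add: poly_inner_conv frob_def)

lemma poly_inner_add_right: "poly_inner A p (f + g) = poly_inner A p f + poly_inner A p g"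
  by (subst (1 2 3) poly_inner_commute) (simp add: poly_inner_add)

lemma poly_inner_smult_right: "poly_inner A p (Polynomial.smult c f) = cnj c * poly_inner A p f"
  by (subst (1 2) poly_inner_commute) (simp add: poly_inner_smult)

lemma poly_inner_zero [simp]: "poly_inner A p 0 = 0" "poly_inner A 0 p = 0"
  by (simp_all add: poly_inner_frob poly_mat_zero frob_def)

text \<open>Void for \<open>k = 0\<close>, where the induction in \<open>orth_below_split\<close>
  starts; at \<open>k = min_poly_degree A\<close> it forces \<open>p(A) = 0\<close> if
  \<open>n > 0\<close>.\<close>

definition orth_below :: "nat \<Rightarrow> complex poly \<Rightarrow> bool" where
  "orth_below k p \<longleftrightarrow> (\<forall>r. degree r < k \<longrightarrow> poly_inner A p r = 0)"

lemma orth_below_diff: "orth_below k p \<Longrightarrow> orth_below k q \<Longrightarrow> orth_below k (p - q)"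
  by (auto simp: orth_below_def poly_inner_diff)

lemma orth_below_smult: "orth_below k p \<Longrightarrow> orth_below k (Polynomial.smult c p)"
  by (auto simp: orth_below_def poly_inner_smult)

text \<open>Subtracting a multiple of the monic \<open>predist A k\<close> removes the leading term.
  The alternative \<open>r' = 0\<close> serves \<open>k = 0\<close>, where no degree is
  smaller.\<close>

lemma predist_remainder:
  assumes "degree r \<le> k"
  obtains r' where "r = Polynomial.smult (coeff r k) (predist A k) + r'" "degree r' < k \<or> r' = 0"
proof
  define r' where "r' = r - Polynomial.smult (coeff r k) (predist A k)"
  show "r = Polynomial.smult (coeff r k) (predist A k) + r'" by (simp add: r'_def)
  have "degree r' \<le> k"
    unfolding r'_def using assms
    by (intro degree_diff_le order.trans[OF degree_smult_le]) (simp_all add: predist_degree)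
  moreover have "coeff r' k = 0"
    using predist_monic[of A k] by (simp add: r'_def predist_degree)
  ultimately show "degree r' < k \<or> r' = 0"
    by (metis leading_coeff_0_iff le_neq_implies_less)
qed

text \<open>Pairwise orthogonality passes to all polynomials of degree below \<open>k\<close> by
  peeling off leading terms.\<close>

lemma orth_below_predist:
  assumes "k < min_poly_degree A"
  shows "orth_below k (predist A k)"
  unfolding orth_below_def
proof (intro allI impI)
  fix r show "degree r < k \<Longrightarrow> poly_inner A (predist A k) r = 0"
  proof (induction "degree r" arbitrary: r rule: less_induct)
    case less
    obtain r' where r': "r = Polynomial.smult (coeff r (degree r)) (predist A (degree r)) + r'"
      "degree r' < degree r \<or> r' = 0"
      by (rule predist_remainder[OF order.refl])
    have "poly_inner A (predist A k) r' = 0"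
      using r'(2) less.hyps[of r'] less.prems by (cases "r' = 0") auto
    then show ?case
      by (subst r'(1)) (simp add: poly_inner_add_right poly_inner_smult_right
          predist_orthogonal[OF less.prems assms])
  qed
qed

lemma orth_below_SucI:
  assumes "orth_below k p" "poly_inner A p (predist A k) = 0"
  shows "orth_below (Suc k) p"
  unfolding orth_below_def
proof (intro allI impI)
  fix r :: "complex poly" assume "degree r < Suc k"
  then obtain r' where r': "r = Polynomial.smult (coeff r k) (predist A k) + r'" "degree r' < k \<or> r' = 0"
    using predist_remainder[of r k] by (metis less_Suc_eq_le)
  have "poly_inner A p r' = 0" using r'(2) assms(1) by (auto simp: orth_below_def)
  then show "poly_inner A p r = 0"
    using assms(2) by (subst r'(1)) (simp add: poly_inner_add_right poly_inner_smult_right)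
qed

lemma orth_below_project:
  assumes "orth_below k p" "k < min_poly_degree A"
  shows "orth_below (Suc k)
    (p - Polynomial.smult (poly_inner A p (predist A k) / poly_inner A (predist A k) (predist A k)) (predist A k))"
  using assms predist_nondegenerate[OF assms(2)]
  by (intro orth_below_SucI orth_below_diff orth_below_smult orth_below_predist)
    (simp_all add: poly_inner_diff poly_inner_smult)

text \<open>\<open>g\<close> is the orthogonal projection of \<open>p\<close> to the polynomials of
  degree below \<open>k\<close>, built up one pre-distance polynomial at a time.\<close>

lemma orth_below_split:
  assumes "k \<le> min_poly_degree A"
  obtains g where "degree g < k \<or> g = 0" "orth_below k (p - g)"
  using assms
proof (induction k arbitrary: thesis)
  case 0
  show ?case by (rule "0.prems"(1)[of 0]) (simp_all add: orth_below_def)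
next
  case (Suc k)
  obtain g where g: "degree g < k \<or> g = 0" "orth_below k (p - g)"
    using Suc.IH[OF _ Suc_leD[OF Suc.prems(2)]] by blast
  define c where "c = poly_inner A (p - g) (predist A k) / poly_inner A (predist A k) (predist A k)"
  show ?case
  proof (rule Suc.prems(1))
    have "degree g \<le> k" using g(1) by auto
    then have "degree (g + Polynomial.smult c (predist A k)) \<le> k"
      by (intro degree_add_le order.trans[OF degree_smult_le]) (simp_all add: predist_degree)
    then show "degree (g + Polynomial.smult c (predist A k)) < Suc k
      \<or> g + Polynomial.smult c (predist A k) = 0" by simp
    show "orth_below (Suc k) (p - (g + Polynomial.smult c (predist A k)))"
      using orth_below_project[OF g(2)] Suc.prems(2) by (simp add: c_def diff_diff_eq)
  qed
qed

lemma poly_mat_reduce: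
  assumes "n > 0"
  obtains p' where "degree p' < min_poly_degree A" "poly_mat p' A = poly_mat p A"
proof -
  obtain m where m: "m \<noteq> 0" "poly_mat m A = 0\<^sub>m n n" "degree m = min_poly_degree A"
    by (rule min_poly_exists) blast
  \<comment> \<open>A constant annihilator would make a nonzero multiple of the identity vanish.
    Positive degree also gives the strict bound when the remainder is zero.\<close>
  have "degree m \<noteq> 0"
  proof
    assume "degree m = 0"
    then obtain c where c: "m = [:c:]" by (rule degree_eq_zeroE)
    then have "m = Polynomial.smult c 1" by simp
    then have "poly_mat m A = c \<cdot>\<^sub>m 1\<^sub>m n" by (simp only: poly_mat_scale poly_mat_one)
    then have "(c \<cdot>\<^sub>m 1\<^sub>m n) $$ (0, 0) = 0\<^sub>m n n $$ (0, 0)" by (simp only: m(2))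
    then have "c = 0" using assms by simp
    then show False using c m(1) by simp
  qed
  have "poly_mat p A = poly_mat (p div m) A * poly_mat m A + poly_mat (p mod m) A"
    unfolding poly_mat_mult[symmetric] poly_mat_plus[symmetric] by simp
  also have "\<dots> = poly_mat (p mod m) A"
    unfolding m(2) by (simp add: right_mult_zero_mat[of _ n n])
  finally have "poly_mat (p mod m) A = poly_mat p A" by simp
  moreover have "degree (p mod m) < degree m"
    using degree_mod_less[OF m(1), of p] \<open>degree m \<noteq> 0\<close> by auto
  ultimately show thesis using that m(3) by metis
qed

text \<open>Modulo the minimal polynomial \<open>p\<close> has a representative of small degree, so
  \<open>p(A)\<close> is orthogonal to itself.\<close>

lemma orth_below_min_poly_degree:
  assumes "n > 0" "orth_below (min_poly_degree A) p"
  shows "poly_mat p A = 0\<^sub>m n n"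
proof -
  obtain p' where p': "degree p' < min_poly_degree A" "poly_mat p' A = poly_mat p A"
    using poly_mat_reduce[OF assms(1)] by blast
  have "poly_inner A p' p' = poly_inner A p p'" by (simp add: poly_inner_frob p'(2))
  also have "\<dots> = 0" using assms(2) p'(1) by (simp add: orth_below_def)
  finally show ?thesis using poly_inner_eq_0_imp[of A p'] p'(2) by simp
qed

end

lemma (in normal_real_mat) poly_inner_transpose:
  assumes "poly_mat q A = T * poly_mat p A"
  shows "poly_inner A q r = poly_inner A p ([:0, 1:] * r)"
  unfolding poly_inner_frob assms poly_mat_mult poly_mat_X by (simp add: frob_mult_transpose)

subsection \<open>Adjacency matrices graded by a distance\<close>

text \<open>What the matrix argument takes from the digraph. \<open>dd\<close> is the directed
  distance, hence not symmetric in general; entries of powers are walk counts, zero below the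
  distance and positive at it.\<close>

locale distance_mat = square_mat +
  fixes dd :: "nat \<Rightarrow> nat \<Rightarrow> nat"
  assumes n_pos: "n > 0"
    and A_index: "\<And>i j. i < n \<Longrightarrow> j < n \<Longrightarrow> A $$ (i, j) = (if dd i j = 1 then 1 else 0)"
    and dd_eq_0_iff: "\<And>i j. i < n \<Longrightarrow> j < n \<Longrightarrow> dd i j = 0 \<longleftrightarrow> i = j"
    and dd_triangle: "\<And>i j l. i < n \<Longrightarrow> j < n \<Longrightarrow> l < n \<Longrightarrow> dd i j \<le> dd i l + dd l j"
    and pow_below: "\<And>i j k. i < n \<Longrightarrow> j < n \<Longrightarrow> k < dd i j \<Longrightarrow> (A ^\<^sub>m k) $$ (i, j) = 0"
    and pow_at: "\<And>i j. i < n \<Longrightarrow> j < n \<Longrightarrow> \<exists>c::nat. c > 0 \<and> (A ^\<^sub>m dd i j) $$ (i, j) = of_nat c"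
begin

lemma pow_at_real:
  assumes "i < n" "j < n"
  shows "(A ^\<^sub>m dd i j) $$ (i, j) = of_real (Re ((A ^\<^sub>m dd i j) $$ (i, j)))"
    and "Re ((A ^\<^sub>m dd i j) $$ (i, j)) > 0"
  using pow_at[OF assms] by auto

lemma pow_at_nonzero: "i < n \<Longrightarrow> j < n \<Longrightarrow> (A ^\<^sub>m dd i j) $$ (i, j) \<noteq> 0"
  using pow_at_real(2)[of i j] by auto

text \<open>Powers below \<open>dd i j\<close> vanish at \<open>(i, j)\<close> and those above
  exceed the degree, so one coefficient survives.\<close>

lemma poly_mat_at:
  assumes "i < n" "j < n" "degree p \<le> dd i j"
  shows "poly_mat p A $$ (i, j) = coeff p (dd i j) * (A ^\<^sub>m dd i j) $$ (i, j)"
proof -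
  have "poly_mat p A $$ (i, j) = (\<Sum>k\<le>dd i j. coeff p k * (A ^\<^sub>m k) $$ (i, j))"
    by (rule poly_mat_index'[OF assms])
  also have "\<dots> = (\<Sum>k\<in>{dd i j}. coeff p k * (A ^\<^sub>m k) $$ (i, j))"
    using assms by (intro sum.mono_neutral_right) (auto simp: pow_below)
  finally show ?thesis by simp
qed

lemma poly_mat_below:
  assumes "i < n" "j < n" "degree p < dd i j"
  shows "poly_mat p A $$ (i, j) = 0"
  using poly_mat_at[of i j p] assms by (simp add: coeff_eq_0)

lemma predist_at:
  assumes "i < n" "j < n"
  shows "poly_mat (predist A (dd i j)) A $$ (i, j) = (A ^\<^sub>m dd i j) $$ (i, j)"
  using poly_mat_at[OF assms, of "predist A (dd i j)"] predist_monic[of A "dd i j"]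
  by (simp add: predist_degree)

definition total_walks :: "nat \<Rightarrow> real" where
  "total_walks k = (\<Sum>i<n. \<Sum>j<n. if dd i j = k then Re ((A ^\<^sub>m k) $$ (i, j)) else 0)"

definition total_pairs :: "nat \<Rightarrow> real" where
  "total_pairs k = (\<Sum>i<n. \<Sum>j<n. if dd i j = k then 1 else 0)"

text \<open>The simple excess in terms of totals over ordered pairs. If no pair has distance
  \<open>k\<close>, division by zero yields the conventional value 0.\<close>

definition excess :: "nat \<Rightarrow> real" where
  "excess k = (total_walks k / n)\<^sup>2 / (total_pairs k / n)"

lemma total_pairs_pos: "i < n \<Longrightarrow> j < n \<Longrightarrow> total_pairs (dd i j) > 0"
  unfolding total_pairs_def by (intro sum_pos2[where i = i] sum_pos2[where i = j] sum_nonneg) auto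

lemma total_walks_pos:
  assumes ij: "i < n" "j < n"
  shows "total_walks (dd i j) > 0"
proof -
  let ?g = "\<lambda>a b. if dd a b = dd i j then Re ((A ^\<^sub>m dd i j) $$ (a, b)) else 0"
  have nonneg: "0 \<le> ?g a b" if "a < n" "b < n" for a b
    using pow_at_real(2)[OF that] by (cases "dd a b = dd i j") auto
  have "0 < (\<Sum>b<n. ?g i b)"
    by (rule sum_pos2[where i = j]) (use ij nonneg[OF ij(1)] pow_at_real(2)[OF ij] in auto)
  then show ?thesis
    unfolding total_walks_def
    by (rule sum_pos2[where i = i, rotated 2]) (use ij in \<open>auto intro!: sum_nonneg nonneg simp del: if_split\<close>)
qed

lemma total_walks_eq_0: "total_pairs k = 0 \<Longrightarrow> total_walks k = 0"
  unfolding total_walks_def using total_pairs_pos by (intro sum.neutral ballI) fastforce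

text \<open>Cauchy-Schwarz for the k-th pre-distance polynomial against the distance-k matrix, with the
  defect written out so that the case of equality can be read off.\<close>

lemma excess_gap:
  fixes k :: nat
  defines "c \<equiv> total_walks k / total_pairs k"
  shows "(\<Sum>i<n. \<Sum>j<n. (cmod (poly_mat (predist A k) A $$ (i, j) - (if dd i j = k then of_real c else 0)))\<^sup>2)
    = n * (spectral_excess A k - excess k)"
proof -
  let ?Q = "\<lambda>i j. poly_mat (predist A k) A $$ (i, j)"
  have "(cmod (?Q i j - (if dd i j = k then of_real c else 0)))\<^sup>2
      = (cmod (?Q i j))\<^sup>2 - 2 * c * (if dd i j = k then Re ((A ^\<^sub>m k) $$ (i, j)) else 0)
        + c\<^sup>2 * (if dd i j = k then 1 else 0)" if "i < n" "j < n" for i j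
  proof (cases "dd i j = k")
    case True
    then have "?Q i j = of_real (Re ((A ^\<^sub>m k) $$ (i, j)))"
      using predist_at[OF that] pow_at_real(1)[OF that] by simp
    then obtain x where "?Q i j = of_real x" "Re ((A ^\<^sub>m k) $$ (i, j)) = x" by blast
    then show ?thesis
      using True by (simp add: power2_diff norm_of_real flip: of_real_diff)
  qed simp
  then have "(\<Sum>i<n. \<Sum>j<n. (cmod (?Q i j - (if dd i j = k then of_real c else 0)))\<^sup>2)
      = (\<Sum>i<n. \<Sum>j<n. (cmod (?Q i j))\<^sup>2 - 2 * c * (if dd i j = k then Re ((A ^\<^sub>m k) $$ (i, j)) else 0)
        + c\<^sup>2 * (if dd i j = k then 1 else 0))"
    by (intro sum.cong refl) simp
  also have "\<dots> = (\<Sum>i<n. \<Sum>j<n. (cmod (?Q i j))\<^sup>2) - 2 * c * total_walks k + c\<^sup>2 * total_pairs k"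
    by (simp only: total_walks_def total_pairs_def sum.distrib sum_subtractf sum_distrib_left)
  also have "(\<Sum>i<n. \<Sum>j<n. (cmod (?Q i j))\<^sup>2) = n * spectral_excess A k"
    using n_pos by (simp add: spectral_excess_def poly_inner_frob frob_conv_norm Re_divide_of_nat
        del: of_real_sum of_real_power)
  also have "n * spectral_excess A k - 2 * c * total_walks k + c\<^sup>2 * total_pairs k
      = n * (spectral_excess A k - excess k)"
    using n_pos total_walks_eq_0[of k]
    by (cases "total_pairs k = 0") (simp_all add: c_def excess_def field_simps power2_eq_square)
  finally show ?thesis .
qed

lemma excess_le_spectral_excess: "excess k \<le> spectral_excess A k"
proof -
  have "0 \<le> n * (spectral_excess A k - excess k)"
    unfolding excess_gap[symmetric] by (intro sum_nonneg) auto
  then show ?thesis using n_pos by (simp add: zero_le_mult_iff)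
qed

lemma excess_eq_imp:
  assumes "excess k = spectral_excess A k" "i < n" "j < n"
  shows "poly_mat (predist A k) A $$ (i, j)
    = (if dd i j = k then of_real (total_walks k / total_pairs k) else 0)"
  using excess_gap[of k] assms by (simp add: sum_nonneg_eq_0_iff sum_nonneg)

text \<open>The pair at distance \<open>k\<close> shows that \<open>c\<close> is a walk count, hence
  real, and that \<open>total_pairs k\<close> is nonzero; then the defect in
  \<open>excess_gap\<close> vanishes.\<close>

lemma excess_eqI:
  assumes Q: "\<And>i j. i < n \<Longrightarrow> j < n \<Longrightarrow> poly_mat (predist A k) A $$ (i, j) = (if dd i j = k then c else 0)"
    and ij: "i < n" "j < n" "dd i j = k"
  shows "excess k = spectral_excess A k"
proof -
  have at: "(A ^\<^sub>m k) $$ (i, j) = c" if "i < n" "j < n" "dd i j = k" for i j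
    using predist_at[OF that(1,2)] Q[OF that(1,2)] that(3) by simp
  define x where "x = Re c"
  have c: "c = of_real x"
    using at[OF ij] pow_at_real(1)[OF ij(1,2)] ij(3) by (simp add: x_def)
  have "total_walks k = x * total_pairs k"
    unfolding total_walks_def total_pairs_def sum_distrib_left
    by (intro sum.cong refl) (auto simp: at x_def)
  then have "total_walks k / total_pairs k = x"
    using total_pairs_pos[OF ij(1,2)] ij(3) by simp
  then have "n * (spectral_excess A k - excess k) = 0"
    unfolding excess_gap[symmetric] by (intro sum.neutral) (simp add: Q c)
  then show ?thesis using n_pos by simp
qed

text \<open>Distance-regularity on indices; \<open>dd i j \<noteq> 0\<close> replaces the range from
  1 to the diameter, which no distance exceeds.\<close>

definition regular :: bool where
  "regular \<longleftrightarrow> (\<exists>a :: nat \<Rightarrow> nat \<Rightarrow> nat. \<forall>i<n. \<forall>j<n. dd i j \<noteq> 0 \<longrightarrow>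
     (\<forall>s\<le>dd i j + 1. card {l. l < n \<and> dd i l = s \<and> dd j l = 1} = a s (dd i j)))"

text \<open>Membership in the span of the distance matrices.\<close>

definition distance_constant :: "complex mat \<Rightarrow> bool" where
  "distance_constant M \<longleftrightarrow> (\<exists>f. \<forall>i<n. \<forall>j<n. M $$ (i, j) = f (dd i j))"

end

locale normal_distance_mat = distance_mat +
  fixes d :: nat
  assumes normal_A: "normal_mat A"
    and card_spectrum: "card (spectrum A) = Suc d"

sublocale normal_distance_mat \<subseteq> normal_real_mat
  by unfold_locales (auto simp: A_index normal_A)

context normal_distance_mat
begin

lemma min_poly_degree: "min_poly_degree A = Suc d"
  by (simp add: min_poly_degree_normal card_spectrum)

lemma spectrum_ne: "spectrum A \<noteq> {}"
  using card_spectrum by auto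

end

subsection \<open>Distance-regularity implies equality\<close>

context normal_distance_mat
begin

lemma regularE:
  assumes "regular"
  obtains a :: "nat \<Rightarrow> nat \<Rightarrow> nat" where "\<And>i j s. i < n \<Longrightarrow> j < n \<Longrightarrow> dd i j \<noteq> 0 \<Longrightarrow> s \<le> dd i j + 1 \<Longrightarrow>
      card {l. l < n \<and> dd i l = s \<and> dd j l = 1} = a s (dd i j)"
proof -
  obtain a :: "nat \<Rightarrow> nat \<Rightarrow> nat" where "\<forall>i<n. \<forall>j<n. dd i j \<noteq> 0 \<longrightarrow>
     (\<forall>s\<le>dd i j + 1. card {l. l < n \<and> dd i l = s \<and> dd j l = 1} = a s (dd i j))"
    using assms unfolding regular_def by (elim exE)
  then show thesis by (intro that) (elim allE impE, assumption+)
qed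

text \<open>\<open>regular\<close> covers nonzero distances only, so the out-degree of
  \<open>j\<close> is read off from an in-neighbour \<open>i\<close>: the out-neighbours of
  \<open>j\<close> lie at distance at most 2 from \<open>i\<close>.\<close>

lemma regular_out_degree:
  assumes "regular"
  obtains r :: nat where "\<And>j. j < n \<Longrightarrow> card {l. l < n \<and> dd j l = 1} = r"
proof -
  obtain a :: "nat \<Rightarrow> nat \<Rightarrow> nat" where a: "\<And>i j s. i < n \<Longrightarrow> j < n \<Longrightarrow> dd i j \<noteq> 0 \<Longrightarrow> s \<le> dd i j + 1 \<Longrightarrow>
      card {l. l < n \<and> dd i l = s \<and> dd j l = 1} = a s (dd i j)"
    using regularE[OF assms] by blast
  show thesis
  proof (cases "n = 1")
    case True
    then show thesis by (intro that[of 0]) (use dd_eq_0_iff[of 0 0] in auto)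
  next
    case False
    show thesis
    proof (rule that[of "\<Sum>s\<le>2. a s 1"])
      fix j assume j: "j < n"
      \<comment> \<open>Any other vertex \<open>h\<close> reaches \<open>j\<close>, and the last arc
        of a shortest walk supplies the in-neighbour.\<close>
      obtain h where h: "h < n" "h \<noteq> j" using False n_pos j
        by (intro that[of "if j = 0 then 1 else 0"]) (auto split: if_splits)
      then obtain k where "dd h j = Suc k" using dd_eq_0_iff[of h j] j by (metis not0_implies_Suc)
      then have "(\<Sum>l<n. (A ^\<^sub>m k) $$ (h, l) * A $$ (l, j)) \<noteq> 0"
        using pow_at_nonzero[OF h(1) j] pow_Suc_index[OF h(1) j, of k] by metis
      then obtain i where i: "i < n" "A $$ (i, j) \<noteq> 0"
        by (metis (no_types, lifting) lessThan_iff mult_zero_right sum.neutral)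
      then have ij: "dd i j = 1" using A_index[OF i(1) j] by (auto split: if_splits)
      have "{l. l < n \<and> dd j l = 1} = (\<Union>s\<le>2. {l. l < n \<and> dd i l = s \<and> dd j l = 1})"
        using dd_triangle[OF i(1) _ j] ij by fastforce
      also have "card \<dots> = (\<Sum>s\<le>2. card {l. l < n \<and> dd i l = s \<and> dd j l = 1})"
        by (subst card_UN_disjoint) auto
      also have "\<dots> = (\<Sum>s\<le>2. a s 1)"
        using a[OF i(1) j] ij by (intro sum.cong) auto
      finally show "card {l. l < n \<and> dd j l = 1} = (\<Sum>s\<le>2. a s 1)" .
    qed
  qed
qed

text \<open>Entry \<open>(i, j)\<close> of \<open>M * T\<close> sums \<open>f (dd i l)\<close> over
  the out-neighbours \<open>l\<close> of \<open>j\<close>, and \<open>regular\<close> counts these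
  by their distance from \<open>i\<close>.\<close>

lemma distance_constant_mult_transpose:
  assumes "regular" and M: "M \<in> carrier_mat n n" "distance_constant M"
  shows "distance_constant (M * T)"
proof -
  obtain r :: nat where r: "\<And>j. j < n \<Longrightarrow> card {l. l < n \<and> dd j l = 1} = r"
    using regular_out_degree[OF assms(1)] by blast
  obtain a :: "nat \<Rightarrow> nat \<Rightarrow> nat" where a: "\<And>i j s. i < n \<Longrightarrow> j < n \<Longrightarrow> dd i j \<noteq> 0 \<Longrightarrow> s \<le> dd i j + 1 \<Longrightarrow>
      card {l. l < n \<and> dd i l = s \<and> dd j l = 1} = a s (dd i j)"
    using regularE[OF assms(1)] by blast
  obtain f where f: "\<And>i j. i < n \<Longrightarrow> j < n \<Longrightarrow> M $$ (i, j) = f (dd i j)"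
    using M(2) unfolding distance_constant_def by blast
  \<comment> \<open>On the diagonal, outside the scope of \<open>regular\<close>, all
    \<open>r\<close> out-neighbours are at distance 1. Elsewhere the triangle inequality bounds
    \<open>s\<close> by \<open>k + 1\<close>.\<close>
  define F where "F k = (if k = 0 then of_nat r * f 1 else \<Sum>s\<le>k + 1. of_nat (a s k) * f s)" for k
  have "(M * T) $$ (i, j) = F (dd i j)" if ij: "i < n" "j < n" for i j
  proof -
    define L where "L = {l. l < n \<and> dd j l = 1}"
    have "(M * T) $$ (i, j) = (\<Sum>l<n. if dd j l = 1 then f (dd i l) else 0)"
      unfolding mult_index[OF M(1) T ij] using ij by (intro sum.cong) (auto simp: f A_index)
    also have "\<dots> = (\<Sum>l\<in>L. f (dd i l))"
      unfolding L_def by (intro sum.mono_neutral_cong_right) auto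
    also have "\<dots> = F (dd i j)"
    proof (cases "dd i j = 0")
      case True
      then have "i = j" using dd_eq_0_iff ij by simp
      then have "(\<Sum>l\<in>L. f (dd i l)) = (\<Sum>l\<in>L. f 1)" by (intro sum.cong) (auto simp: L_def)
      then show ?thesis using True r[OF ij(2)] by (simp add: F_def L_def)
    next
      case False
      have "dd i ` L \<subseteq> {..dd i j + 1}" using dd_triangle[OF ij(1) _ ij(2)] by (force simp: L_def)
      then have "(\<Sum>l\<in>L. f (dd i l)) = (\<Sum>s\<le>dd i j + 1. \<Sum>l\<in>{l \<in> L. dd i l = s}. f (dd i l))"
        by (intro sum.group[symmetric]) (auto simp: L_def)
      also have "\<dots> = (\<Sum>s\<le>dd i j + 1. of_nat (card {l \<in> L. dd i l = s}) * f s)"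
        by (intro sum.cong refl) simp
      also have "\<dots> = (\<Sum>s\<le>dd i j + 1. of_nat (a s (dd i j)) * f s)"
      proof (intro sum.cong refl)
        fix s assume s: "s \<in> {..dd i j + 1}"
        have "{l \<in> L. dd i l = s} = {l. l < n \<and> dd i l = s \<and> dd j l = 1}" by (auto simp: L_def)
        then show "of_nat (card {l \<in> L. dd i l = s}) * f s = of_nat (a s (dd i j)) * f s"
          using a[OF ij False, of s] s by simp
      qed
      finally show ?thesis using False by (simp add: F_def)
    qed
    finally show ?thesis .
  qed
  then show ?thesis unfolding distance_constant_def by blast
qed

lemma distance_constant_lin:
  assumes "distance_constant M" "distance_constant N"
    and "\<And>i j. i < n \<Longrightarrow> j < n \<Longrightarrow> R $$ (i, j) = c * M $$ (i, j) + N $$ (i, j)"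
  shows "distance_constant R"
proof -
  obtain f g where "\<And>i j. i < n \<Longrightarrow> j < n \<Longrightarrow> M $$ (i, j) = f (dd i j)"
    "\<And>i j. i < n \<Longrightarrow> j < n \<Longrightarrow> N $$ (i, j) = g (dd i j)"
    using assms(1,2) unfolding distance_constant_def by blast
  then show ?thesis
    unfolding distance_constant_def by (intro exI[of _ "\<lambda>k. c * f k + g k"]) (simp add: assms(3))
qed

text \<open>\<open>T\<close> is normal too, so \<open>A\<close> is a polynomial in \<open>T\<close>
  and closure under \<open>T\<close> carries over to \<open>A\<close>.\<close>

lemma distance_constant_mult:
  assumes "regular" and M: "M \<in> carrier_mat n n" "distance_constant M"
  shows "distance_constant (M * A)"
proof -
  interpret tr: normal_real_mat T n by (rule normal_real_mat_transpose)
  obtain q where q: "poly_mat q T = A"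
    using tr.transpose_eq_poly_mat spectrum_non_empty[OF T] n_pos by auto
  have "distance_constant (M * poly_mat p T)" for p
  proof (induction p)
    case 0
    show ?case
      using M(1) unfolding distance_constant_def
      by (intro exI[of _ "\<lambda>_. 0"]) (simp add: tr.poly_mat_zero right_mult_zero_mat[of _ n n])
  next
    case (pCons c p)
    have "M * (poly_mat p T * T) = M * poly_mat p T * T"
      using assoc_mult_mat[OF M(1) tr.poly_mat_carrier T] by simp
    then have "distance_constant (M * (poly_mat p T * T))"
      using distance_constant_mult_transpose[OF assms(1) _ pCons.IH] M(1) mult_carrier_mat tr.poly_mat_carrier
      by metis
    moreover have "(M * poly_mat (pCons c p) T) $$ (i, j) = c * M $$ (i, j) + (M * (poly_mat p T * T)) $$ (i, j)"
      if ij: "i < n" "j < n" for i j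
    proof -
      have "poly_mat (pCons c p) T = c \<cdot>\<^sub>m 1\<^sub>m n + poly_mat p T * T"
        using tr.poly_mat_plus[of "[:c:]" "pCons 0 p"] tr.poly_mat_scale[of c 1]
        by (simp add: tr.poly_mat_one tr.poly_mat_shift)
      then have "M * poly_mat (pCons c p) T = M * (c \<cdot>\<^sub>m 1\<^sub>m n) + M * (poly_mat p T * T)"
        using mult_add_distrib_mat[OF M(1), of "c \<cdot>\<^sub>m 1\<^sub>m n" n "poly_mat p T * T"]
          mult_carrier_mat[OF tr.poly_mat_carrier T] by simp
      also have "M * (c \<cdot>\<^sub>m 1\<^sub>m n) = c \<cdot>\<^sub>m M"
        using M(1) mult_smult_distrib[OF M(1) one_carrier_mat] right_mult_one_mat[OF M(1)] by simp
      finally show ?thesis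
        using ij M(1) by (simp del: index_mult_mat(1))
    qed
    ultimately show ?case using M(2) distance_constant_lin by blast
  qed
  from this[of q] show ?thesis by (simp add: q)
qed

lemma distance_constant_poly_mat:
  assumes "regular"
  shows "distance_constant (poly_mat p A)"
proof (induction p)
  case 0
  show ?case by (auto simp: poly_mat_zero distance_constant_def)
next
  case (pCons c p)
  have "distance_constant (1\<^sub>m n)"
    unfolding distance_constant_def
    by (intro exI[of _ "\<lambda>k. if k = 0 then 1 else 0"]) (simp add: dd_eq_0_iff)
  moreover have "distance_constant (poly_mat p A * A)"
    using assms pCons.IH by (intro distance_constant_mult) auto
  moreover have "poly_mat (pCons c p) A $$ (i, j) = c * 1\<^sub>m n $$ (i, j) + (poly_mat p A * A) $$ (i, j)"
    if ij: "i < n" "j < n" for i j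
    using poly_mat_add[of i A j "[:c:]" "pCons 0 p"] poly_mat_smult[of i A j c 1] ij
    by (simp add: poly_mat_one poly_mat_shift del: index_mult_mat(1))
  ultimately show ?case by (rule distance_constant_lin)
qed

lemma regular_imp_excess_eq:
  assumes "regular"
  shows "excess d = spectral_excess A d"
proof -
  let ?Q = "poly_mat (predist A d) A"
  obtain f where f: "\<And>i j. i < n \<Longrightarrow> j < n \<Longrightarrow> ?Q $$ (i, j) = f (dd i j)"
    using distance_constant_poly_mat[OF assms] unfolding distance_constant_def by blast
  \<comment> \<open>Pairing with \<open>A ^\<^sub>m k\<close> isolates class \<open>k\<close>: the
    power vanishes at larger distances and \<open>f\<close> at smaller ones by induction, which
    leaves \<open>f k\<close> times the positive \<open>total_walks k\<close>.\<close>
  have below: "\<forall>i<n. \<forall>j<n. dd i j = k \<longrightarrow> k < d \<longrightarrow> f k = 0" for k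
  proof (induction k rule: less_induct)
    case (less k)
    show ?case
    proof (intro allI impI)
      fix i j assume ij: "i < n" "j < n" "dd i j = k" "k < d"
      have "poly_inner A (predist A d) (monom 1 k) = 0"
        using orth_below_predist[of d] ij(4) by (auto simp: orth_below_def min_poly_degree degree_monom_eq)
      then have "0 = (\<Sum>i<n. \<Sum>j<n. ?Q $$ (i, j) * cnj ((A ^\<^sub>m k) $$ (i, j)))"
        using n_pos by (simp add: poly_inner_frob poly_mat_monom frob_def)
      also have "\<dots> = (\<Sum>i<n. \<Sum>j<n. f k * of_real (if dd i j = k then Re ((A ^\<^sub>m k) $$ (i, j)) else 0))"
      proof (intro sum.cong refl)
        fix i j assume "i \<in> {..<n}" "j \<in> {..<n}"
        then have ij': "i < n" "j < n" by auto
        show "?Q $$ (i, j) * cnj ((A ^\<^sub>m k) $$ (i, j))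
            = f k * of_real (if dd i j = k then Re ((A ^\<^sub>m k) $$ (i, j)) else 0)"
        proof (cases k "dd i j" rule: linorder_cases)
          case less
          then show ?thesis using pow_below[OF ij' less] by simp
        next
          case equal
          then have "cnj ((A ^\<^sub>m k) $$ (i, j)) = of_real (Re ((A ^\<^sub>m k) $$ (i, j)))"
            using pow_at_real(1)[OF ij'] by (metis complex_cnj_complex_of_real)
          then show ?thesis using equal f[OF ij'] by simp
        next
          case greater
          then have "f (dd i j) = 0" using less.IH[of "dd i j"] ij' ij(4) by simp
          then show ?thesis using greater f[OF ij'] by simp
        qed
      qed
      also have "\<dots> = f k * of_real (total_walks k)"
        by (simp only: total_walks_def of_real_sum sum_distrib_left)
      finally show "f k = 0" using total_walks_pos[OF ij(1,2)] ij(3) by simp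
    qed
  qed
  have above: "?Q $$ (i, j) = 0" if "i < n" "j < n" "dd i j > d" for i j
    using that by (intro poly_mat_below) (simp_all add: predist_degree)
  have off: "?Q $$ (i, j) = 0" if "i < n" "j < n" "dd i j \<noteq> d" for i j
    using that below[of "dd i j"] above[of i j] f[of i j] by (metis nat_neq_iff)
  \<comment> \<open>\<open>predist A d\<close> does not annihilate \<open>A\<close>, so some pair is
    at distance exactly \<open>d\<close>.\<close>
  have "poly_inner A (predist A d) (predist A d) \<noteq> 0"
    by (rule predist_nondegenerate) (simp add: min_poly_degree)
  then have "\<exists>i<n. \<exists>j<n. ?Q $$ (i, j) \<noteq> 0"
    unfolding poly_inner_frob frob_def by (auto intro!: sum.neutral)
  then obtain i j where "i < n" "j < n" "dd i j = d" using off by blast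
  then show ?thesis
    using off f by (intro excess_eqI[where c = "f d"]) auto
qed

end

subsection \<open>Equality implies distance-regularity\<close>

text \<open>For \<open>y\<close> with \<open>A y = r y\<close>, regularity makes the energy \<open>\<Sum>i j. A\<^sub>i\<^sub>j |y i - y j|\<^sup>2\<close> vanish.\<close>

lemma (in distance_mat) harmonic_imp_constant:
  fixes y :: "nat \<Rightarrow> complex" and r :: real
  assumes out_deg: "\<And>i. i < n \<Longrightarrow> (\<Sum>l<n. A $$ (i, l)) = of_real r"
    and in_deg: "\<And>l. l < n \<Longrightarrow> (\<Sum>i<n. A $$ (i, l)) = of_real r"
    and eigen: "\<And>i. i < n \<Longrightarrow> (\<Sum>l<n. A $$ (i, l) * y l) = of_real r * y i"
    and ij: "i < n" "j < n"
  shows "y i = y j"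
proof -
  have real: "cnj (A $$ (i, l)) = A $$ (i, l)" if "i < n" "l < n" for i l
    using that by (simp add: A_index)
  define w where "w i l = (if dd i l = 1 then (cmod (y i - y l))\<^sup>2 else 0)" for i l
  define E where "E = (\<Sum>i<n. y i * cnj (y i))"
  \<comment> \<open>Facts 1 to 4 are the terms of the expanded energy; row sums, column sums, the
    eigenvector equation and its conjugate make each equal to \<open>r * E\<close>.\<close>
  have 1: "(\<Sum>i<n. \<Sum>l<n. A $$ (i, l) * (y i * cnj (y i))) = of_real r * E"
    unfolding E_def sum_distrib_right[symmetric] sum_distrib_left
    by (intro sum.cong refl) (simp add: out_deg)
  have 2: "(\<Sum>i<n. \<Sum>l<n. A $$ (i, l) * (y l * cnj (y l))) = of_real r * E"
    by (subst sum.swap) (simp add: E_def in_deg sum_distrib_left flip: sum_distrib_right)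
  have 3: "(\<Sum>i<n. \<Sum>l<n. A $$ (i, l) * y l * cnj (y i)) = of_real r * E"
    unfolding sum_distrib_right[symmetric] E_def sum_distrib_left
    by (intro sum.cong refl) (simp add: eigen)
  have "(\<Sum>i<n. \<Sum>l<n. A $$ (i, l) * y i * cnj (y l)) = cnj (\<Sum>i<n. \<Sum>l<n. A $$ (i, l) * y l * cnj (y i))"
    unfolding cnj_sum by (intro sum.cong refl) (simp add: real mult_ac)
  also have "\<dots> = of_real r * E" unfolding 3 E_def by (simp add: mult.commute)
  finally have 4: "(\<Sum>i<n. \<Sum>l<n. A $$ (i, l) * y i * cnj (y l)) = of_real r * E" .
  have "complex_of_real (\<Sum>i<n. \<Sum>l<n. w i l)
      = (\<Sum>i<n. \<Sum>l<n. A $$ (i, l) * ((y i - y l) * cnj (y i - y l)))"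
    unfolding of_real_sum by (intro sum.cong refl) (simp add: w_def A_index complex_norm_square del: of_real_power complex_cnj_diff)
  also have "\<dots> = (\<Sum>i<n. \<Sum>l<n. A $$ (i, l) * (y i * cnj (y i)) + A $$ (i, l) * (y l * cnj (y l))
      - A $$ (i, l) * y l * cnj (y i) - A $$ (i, l) * y i * cnj (y l))"
    by (intro sum.cong refl) (simp add: algebra_simps)
  also have "\<dots> = 0" unfolding sum_subtractf sum.distrib 1 2 3 4 by simp
  finally have "(\<Sum>i<n. \<Sum>l<n. w i l) = 0" by (simp only: of_real_eq_0_iff)
  then have arc: "y a = y b" if "a < n" "b < n" "A $$ (a, b) \<noteq> 0" for a b
    using that by (auto simp: sum_nonneg_eq_0_iff sum_nonneg w_def A_index split: if_splits)
  \<comment> \<open>Equality spreads from arcs along walks, and some walk leads from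
    \<open>i\<close> to \<open>j\<close>.\<close>
  have "y i = y j" if "j < n" "(A ^\<^sub>m k) $$ (i, j) \<noteq> 0" for k j
    using that
  proof (induction k arbitrary: j)
    case 0
    then show ?case using ij(1) by (auto split: if_splits)
  next
    case (Suc k)
    obtain l where l: "l < n" "(A ^\<^sub>m k) $$ (i, l) * A $$ (l, j) \<noteq> 0"
      using Suc.prems(2) unfolding pow_Suc_index[OF ij(1) Suc.prems(1)]
      by (metis (no_types, lifting) lessThan_iff sum.neutral)
    then show ?case using Suc.IH[of l] arc[of l j] Suc.prems(1) by auto
  qed
  then show ?thesis using pow_at_nonzero[OF ij] ij(2) by blast
qed

locale extremal_distance_mat = normal_distance_mat +
  assumes extremal: "excess d = spectral_excess A d"
begin

lemma predist_d_off: "i < n \<Longrightarrow> j < n \<Longrightarrow> dd i j \<noteq> d \<Longrightarrow> poly_mat (predist A d) A $$ (i, j) = 0"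
  using excess_eq_imp[OF extremal] by simp

text \<open>The induction runs downwards in k: multiplying by the transpose, which is itself a polynomial
  in A, shifts the support of the (k+1)-st pre-distance polynomial by at most one step.\<close>

lemma orth_below_imp_zero:
  assumes "k \<le> Suc d" "orth_below k p" "i < n" "j < n" "dd i j < k"
  shows "poly_mat p A $$ (i, j) = 0"
  using assms
proof (induction "Suc d - k" arbitrary: k p i j)
  case 0
  then have "orth_below (min_poly_degree A) p" by (simp add: min_poly_degree)
  then show ?case using orth_below_min_poly_degree[OF n_pos] 0 by simp
next
  case (Suc e)
  then have k: "k \<le> d" by simp
  have IH: "poly_mat p A $$ (i, j) = 0"
    if "orth_below (Suc k) p" "i < n" "j < n" "dd i j < Suc k" for p i j
    using Suc.hyps(1)[of "Suc k" p i j] Suc.hyps(2) that k by simp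
  show ?case
  proof (cases "k = d")
    case True
    \<comment> \<open>The component along \<open>predist A d\<close> vanishes off distance
      \<open>d\<close> by the case of equality; the rest falls under the induction
      hypothesis.\<close>
    define t where "t = poly_inner A p (predist A d) / poly_inner A (predist A d) (predist A d)"
    have "poly_mat (p - Polynomial.smult t (predist A d)) A $$ (i, j) = 0"
      using Suc.prems True by (intro IH) (auto simp: t_def min_poly_degree intro!: orth_below_project)
    then show ?thesis
      using Suc.prems True predist_d_off[of i j] by (simp add: poly_mat_diff poly_mat_smult)
  next
    case False
    then have k: "Suc k < min_poly_degree A" using k by (simp add: min_poly_degree)
    obtain u where u: "poly_mat u A = T"
      using transpose_eq_poly_mat[OF spectrum_ne] by blast
    \<comment> \<open>\<open>q\<close> stands in for \<open>predist A k\<close>, whose support is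
      not yet known: subtracting a multiple of \<open>q\<close> from \<open>p\<close> gains one
      degree of orthogonality, and the support of \<open>q\<close> is controlled by that of
      \<open>predist A (Suc k)\<close>.\<close>
    define q where "q = u * predist A (Suc k)"
    have q: "poly_mat q A = T * poly_mat (predist A (Suc k)) A"
      by (simp add: q_def poly_mat_mult u)
    have orth: "orth_below (Suc k) (predist A (Suc k))" by (rule orth_below_predist[OF k])
    have q_orth: "orth_below k q"
      unfolding orth_below_def
    proof (intro allI impI)
      fix r :: "complex poly" assume "degree r < k"
      then have "degree ([:0, 1:] * r) < Suc k" by (auto intro!: le_less_trans[OF degree_pCons_le])
      then show "poly_inner A q r = 0"
        using orth unfolding poly_inner_transpose[OF q] orth_below_def by blast
    qed
    \<comment> \<open>\<open>x\<close> times \<open>predist A k\<close> is monic of degree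
      \<open>k + 1\<close>, so it is \<open>predist A (Suc k)\<close> plus lower terms.\<close>
    have "poly_inner A q (predist A k) = poly_inner A (predist A (Suc k)) (predist A (Suc k))"
    proof -
      define s where "s = [:0, 1:] * predist A k"
      have "degree s \<le> Suc k"
        unfolding s_def using degree_pCons_le[of 0 "predist A k"] by (simp add: predist_degree)
      then obtain s' where s': "s = Polynomial.smult (coeff s (Suc k)) (predist A (Suc k)) + s'"
        "degree s' < Suc k \<or> s' = 0" by (rule predist_remainder)
      have "coeff s (Suc k) = 1"
        using predist_monic[of A k] by (simp add: s_def predist_degree)
      then have "s = predist A (Suc k) + s'" using s'(1) by simp
      moreover have "poly_inner A (predist A (Suc k)) s' = 0"
        using s'(2) orth by (auto simp: orth_below_def)
      ultimately show ?thesis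
        unfolding poly_inner_transpose[OF q] s_def[symmetric] by (simp add: poly_inner_add_right)
    qed
    then have nz: "poly_inner A q (predist A k) \<noteq> 0" using predist_nondegenerate[OF k] by simp
    define t where "t = poly_inner A p (predist A k) / poly_inner A q (predist A k)"
    have "orth_below (Suc k) (p - Polynomial.smult t q)"
      using nz Suc.prems(2) q_orth
      by (intro orth_below_SucI orth_below_diff orth_below_smult)
        (simp_all add: poly_inner_diff poly_inner_smult t_def)
    then have "poly_mat (p - Polynomial.smult t q) A $$ (i, j) = 0"
      using Suc.prems by (intro IH) auto
    moreover have "poly_mat q A $$ (i, j) = 0"
    proof -
      have "poly_mat q A $$ (i, j) = (\<Sum>l<n. T $$ (i, l) * poly_mat (predist A (Suc k)) A $$ (l, j))"
        unfolding q using Suc.prems by (intro mult_index) auto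
      also have "\<dots> = 0"
      proof (intro sum.neutral ballI)
        fix l assume "l \<in> {..<n}"
        then have l: "l < n" by simp
        show "T $$ (i, l) * poly_mat (predist A (Suc k)) A $$ (l, j) = 0"
        \<comment> \<open>\<open>T $$ (i, l)\<close> is nonzero only for an arc from
          \<open>l\<close> to \<open>i\<close>, and then \<open>dd l j\<close> exceeds
          \<open>dd i j\<close> by at most 1.\<close>
        proof (cases "dd l i = 1")
          case True
          then have "dd l j < Suc k" using dd_triangle[OF l Suc.prems(4,3)] Suc.prems(5) by simp
          then show ?thesis using IH[OF orth l Suc.prems(4)] by simp
        qed (use l Suc.prems A_index in auto)
      qed
      finally show ?thesis .
    qed
    ultimately show ?thesis using Suc.prems by (simp add: poly_mat_diff poly_mat_smult)
  qed
qed

text \<open>With \<open>g\<close> the projection of \<open>p\<close> to degree at most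
  \<open>k\<close>, the rest \<open>p - g\<close> vanishes at distance \<open>k\<close> by
  \<open>orth_below_imp_zero\<close>, and only the degree \<open>k\<close> term of \<open>g\<close>
  contributes there.\<close>

lemma poly_mat_proportional:
  assumes "k \<le> d"
  obtains t where "\<And>i j. i < n \<Longrightarrow> j < n \<Longrightarrow> dd i j = k \<Longrightarrow> poly_mat p A $$ (i, j) = t * (A ^\<^sub>m k) $$ (i, j)"
proof -
  obtain g where g: "degree g < Suc k \<or> g = 0" "orth_below (Suc k) (p - g)"
    using orth_below_split[of "Suc k" p] assms by (auto simp: min_poly_degree)
  show thesis
  proof (rule that)
    fix i j assume ij: "i < n" "j < n" "dd i j = k"
    have "poly_mat (p - g) A $$ (i, j) = 0"
      using assms g(2) ij by (intro orth_below_imp_zero[of "Suc k"]) auto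
    then have "poly_mat p A $$ (i, j) = poly_mat g A $$ (i, j)" using ij by (simp add: poly_mat_diff)
    also have "\<dots> = coeff g k * (A ^\<^sub>m k) $$ (i, j)"
      using ij g(1) by (subst poly_mat_at) auto
    finally show "poly_mat p A $$ (i, j) = coeff g k * (A ^\<^sub>m k) $$ (i, j)" .
  qed
qed

section \<open>Constant diagonals, regular degrees and the all-ones matrix\<close>

lemma poly_mat_diag_constant:
  obtains t where "\<And>i. i < n \<Longrightarrow> poly_mat p A $$ (i, i) = t"
proof -
  obtain t where t: "\<And>i j. i < n \<Longrightarrow> j < n \<Longrightarrow> dd i j = 0 \<Longrightarrow> poly_mat p A $$ (i, j) = t * (A ^\<^sub>m 0) $$ (i, j)"
    using poly_mat_proportional[of 0 p] by blast
  show thesis by (rule that[of t]) (simp add: t dd_eq_0_iff)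
qed

text \<open>The diagonals of \<open>A * T\<close> and \<open>T * A\<close> hold the out-degrees and
  the in-degrees; both products are the same polynomial in \<open>A\<close>, which has constant
  diagonal.\<close>

lemma degree_regular:
  obtains r :: real where "\<And>i. i < n \<Longrightarrow> (\<Sum>l<n. A $$ (i, l)) = of_real r"
    and "\<And>l. l < n \<Longrightarrow> (\<Sum>i<n. A $$ (i, l)) = of_real r"
proof -
  obtain u where u: "poly_mat u A = T"
    using transpose_eq_poly_mat[OF spectrum_ne] by blast
  obtain t where t: "\<And>i. i < n \<Longrightarrow> poly_mat ([:0, 1:] * u) A $$ (i, i) = t"
    using poly_mat_diag_constant by blast
  have AT: "poly_mat ([:0, 1:] * u) A = A * T" by (simp only: poly_mat_mult poly_mat_X u)
  have sq: "A $$ (i, l) * A $$ (i, l) = A $$ (i, l)" if "i < n" "l < n" for i l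
    using that by (simp add: A_index)
  have out_deg: "(\<Sum>l<n. A $$ (i, l)) = t" if "i < n" for i
  proof -
    have "t = (A * T) $$ (i, i)" using t[OF that] by (simp only: AT)
    also have "\<dots> = (\<Sum>l<n. A $$ (i, l) * T $$ (l, i))" using that by (intro mult_index A T)
    also have "\<dots> = (\<Sum>l<n. A $$ (i, l))" using that by (intro sum.cong) (auto simp: sq)
    finally show ?thesis by simp
  qed
  have in_deg: "(\<Sum>i<n. A $$ (i, l)) = t" if "l < n" for l
  proof -
    have "t = (T * A) $$ (l, l)" using t[OF that] normal by (simp only: AT normal_mat_def)
    also have "\<dots> = (\<Sum>i<n. T $$ (l, i) * A $$ (i, l))" using that by (intro mult_index A T)
    also have "\<dots> = (\<Sum>i<n. A $$ (i, l))" using that by (intro sum.cong) (auto simp: sq)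
    finally show ?thesis by simp
  qed
  have "t \<in> \<real>"
    unfolding out_deg[OF n_pos, symmetric] by (intro sum_in_Reals) (auto simp: A_index n_pos)
  then obtain r where "t = of_real r" by (auto elim: Reals_cases)
  then show thesis using that[of r] out_deg in_deg by simp
qed

text \<open>The witness is a multiple of the Hoffman polynomial.\<close>

lemma all_ones_poly:
  obtains h where "\<And>i j. i < n \<Longrightarrow> j < n \<Longrightarrow> poly_mat h A $$ (i, j) = 1"
proof -
  obtain r :: real where r: "\<And>i. i < n \<Longrightarrow> (\<Sum>l<n. A $$ (i, l)) = of_real r"
    "\<And>l. l < n \<Longrightarrow> (\<Sum>i<n. A $$ (i, l)) = of_real r"
    using degree_regular by blast
  define S where "S = spectrum A"
  define X :: "complex mat" where "X = mat n 1 (\<lambda>_. 1)"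
  \<comment> \<open>Row sums \<open>r\<close> make the all-ones vector an eigenvector, so
    \<open>r\<close> is a root of the annihilating product.\<close>
  have "(\<Sum>l<n. poly_mat (\<Prod>c\<in>S. [:- c, 1:]) A $$ (0, l) * X $$ (l, 0))
      = poly (\<Prod>c\<in>S. [:- c, 1:]) (of_real r) * X $$ (0, 0)"
    using n_pos by (intro poly_mat_eigen[where m = 1]) (auto simp: X_def r)
  then have "poly (\<Prod>c\<in>S. [:- c, 1:]) (of_real r) = 0"
    using n_pos by (simp add: poly_mat_prod_spectrum S_def X_def)
  then have rS: "complex_of_real r \<in> S"
    using finite_spectrum by (auto simp: poly_prod S_def)
  define H where "H = (\<Prod>c\<in>S - {of_real r}. [:- c, 1:])"
  have "[:- of_real r, 1:] * H = (\<Prod>c\<in>S. [:- c, 1:])"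
    using rS finite_spectrum by (simp only: H_def S_def prod.remove)
  then have AH: "A * poly_mat H A = of_real r \<cdot>\<^sub>m poly_mat H A"
    using poly_mat_prod_spectrum by (simp only: S_def flip: linear_factor_annihilates_iff)
  \<comment> \<open>Each column of \<open>H(A)\<close> is an eigenvector for \<open>r\<close> or
    zero, hence constant; the constant diagonal then makes all columns equal.\<close>
  have column: "poly_mat H A $$ (i, j) = poly_mat H A $$ (j, j)" if "i < n" "j < n" for i j
  proof (rule harmonic_imp_constant[OF r, where y = "\<lambda>i. poly_mat H A $$ (i, j)"])
    fix i assume i: "i < n"
    then show "(\<Sum>l<n. A $$ (i, l) * poly_mat H A $$ (l, j)) = of_real r * poly_mat H A $$ (i, j)"
      using that mult_index[OF A poly_mat_carrier i \<open>j < n\<close>, of H] by (simp add: AH)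
  qed (use that in auto)
  obtain t where t: "\<And>i. i < n \<Longrightarrow> poly_mat H A $$ (i, i) = t"
    using poly_mat_diag_constant by blast
  have Ht: "poly_mat H A $$ (i, j) = t" if "i < n" "j < n" for i j
    using column[OF that] t[OF that(2)] by simp
  \<comment> \<open>\<open>H\<close> has too small a degree to annihilate \<open>A\<close>.\<close>
  have "t \<noteq> 0"
  proof
    assume "t = 0"
    then have "poly_mat H A = 0\<^sub>m n n" using Ht by (intro eq_matI) auto
    moreover have "H \<noteq> 0" using finite_spectrum by (simp add: H_def S_def)
    ultimately have "card S \<le> degree H" unfolding S_def by (intro card_spectrum_le_degree)
    moreover have "degree H = card (S - {of_real r})" by (simp add: H_def degree_prod_sum_eq)
    moreover have "card (S - {of_real r}) < card S"
      using rS finite_spectrum by (intro card_Diff1_less) (simp_all add: S_def)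
    ultimately show False by simp
  qed
  then show thesis
    using that[of "Polynomial.smult (inverse t) H"] Ht by (simp add: poly_mat_smult)
qed

text \<open>The all-ones matrix is a polynomial in \<open>A\<close> of degree at most
  \<open>d\<close>, and such a polynomial vanishes at distances beyond \<open>d\<close>.\<close>

lemma dd_le: "i < n \<Longrightarrow> j < n \<Longrightarrow> dd i j \<le> d"
proof (rule ccontr)
  assume ij: "i < n" "j < n" "\<not> dd i j \<le> d"
  obtain h where h: "\<And>i j. i < n \<Longrightarrow> j < n \<Longrightarrow> poly_mat h A $$ (i, j) = 1"
    using all_ones_poly by blast
  obtain h' where h': "degree h' < Suc d" "poly_mat h' A = poly_mat h A"
    using poly_mat_reduce[OF n_pos, of h] unfolding min_poly_degree by blast
  have "poly_mat h' A $$ (i, j) = 0" using ij h'(1) by (intro poly_mat_below) auto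
  then show False using h[OF ij(1,2)] h'(2) by simp
qed

text \<open>At distance \<open>k\<close> the all-ones matrix is \<open>t\<close> times the walk
  count, so this count is \<open>inverse t\<close> for every such pair. If no pair has distance
  \<open>k\<close>, any nonzero \<open>c\<close> serves.\<close>

lemma pow_at_constant:
  assumes "k \<le> d"
  obtains c where "c \<noteq> 0" "\<And>i j. i < n \<Longrightarrow> j < n \<Longrightarrow> dd i j = k \<Longrightarrow> (A ^\<^sub>m k) $$ (i, j) = c"
proof (cases "\<exists>i<n. \<exists>j<n. dd i j = k")
  case True
  obtain h where h: "\<And>i j. i < n \<Longrightarrow> j < n \<Longrightarrow> poly_mat h A $$ (i, j) = 1"
    using all_ones_poly by blast
  obtain t where t: "\<And>i j. i < n \<Longrightarrow> j < n \<Longrightarrow> dd i j = k \<Longrightarrow> poly_mat h A $$ (i, j) = t * (A ^\<^sub>m k) $$ (i, j)"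
    using poly_mat_proportional[OF assms] by blast
  have 1: "t * (A ^\<^sub>m k) $$ (i, j) = 1" if "i < n" "j < n" "dd i j = k" for i j
    using h[OF that(1,2)] t[OF that] by simp
  have "t \<noteq> 0" using True 1 by fastforce
  then show thesis using that[of "inverse t"] 1 by (simp add: field_simps)
next
  case False
  then show thesis using that[of 1] by auto
qed

lemma distance_constant_poly: "distance_constant (poly_mat p A)"
proof -
  have "\<exists>c. \<forall>i<n. \<forall>j<n. dd i j = k \<longrightarrow> poly_mat p A $$ (i, j) = c" for k
  proof (cases "k \<le> d")
    case True
    obtain t where "\<And>i j. i < n \<Longrightarrow> j < n \<Longrightarrow> dd i j = k \<Longrightarrow> poly_mat p A $$ (i, j) = t * (A ^\<^sub>m k) $$ (i, j)"
      using poly_mat_proportional[OF True] by blast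
    moreover obtain c where "c \<noteq> 0"
      "\<And>i j. i < n \<Longrightarrow> j < n \<Longrightarrow> dd i j = k \<Longrightarrow> (A ^\<^sub>m k) $$ (i, j) = c"
      using pow_at_constant[OF True] by metis
    ultimately show ?thesis by (intro exI[of _ "t * c"]) simp
  qed (use dd_le in blast)
  then have "\<exists>f. \<forall>k. \<forall>i<n. \<forall>j<n. dd i j = k \<longrightarrow> poly_mat p A $$ (i, j) = f k"
    by (intro choice allI)
  then show ?thesis unfolding distance_constant_def by blast
qed

text \<open>A rescaled \<open>predist A s\<close> works: orthogonality kills the smaller distances
  and the degree kills the larger ones.\<close>

lemma distance_mat_poly:
  obtains p where "\<And>i j. i < n \<Longrightarrow> j < n \<Longrightarrow> poly_mat p A $$ (i, j) = (if dd i j = s then 1 else 0)"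
proof (cases "s \<le> d")
  case True
  obtain c where c: "c \<noteq> 0" "\<And>i j. i < n \<Longrightarrow> j < n \<Longrightarrow> dd i j = s \<Longrightarrow> (A ^\<^sub>m s) $$ (i, j) = c"
    using pow_at_constant[OF True] by blast
  show thesis
  proof (rule that[of "Polynomial.smult (inverse c) (predist A s)"])
    fix i j assume ij: "i < n" "j < n"
    show "poly_mat (Polynomial.smult (inverse c) (predist A s)) A $$ (i, j) = (if dd i j = s then 1 else 0)"
    proof (cases "dd i j" s rule: linorder_cases)
      case less
      then have "poly_mat (predist A s) A $$ (i, j) = 0"
        using True ij by (intro orth_below_imp_zero[of s] orth_below_predist) (auto simp: min_poly_degree)
      then show ?thesis using less ij by (simp add: poly_mat_smult)
    next
      case equal
      then show ?thesis using predist_at[OF ij] c ij by (simp add: poly_mat_smult)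
    next
      case greater
      then have "poly_mat (predist A s) A $$ (i, j) = 0"
        using ij by (intro poly_mat_below) (simp_all add: predist_degree)
      then show ?thesis using greater ij by (simp add: poly_mat_smult)
    qed
  qed
next
  case False
  show thesis by (rule that[of 0]) (use False dd_le in \<open>force simp: poly_mat_zero\<close>)
qed

text \<open>The distance-\<open>s\<close> matrix times \<open>T\<close> has these cardinalities as
  entries and is a polynomial in \<open>A\<close>, hence constant on distance classes.\<close>

lemma regular: "regular"
proof -
  obtain u where u: "poly_mat u A = T"
    using transpose_eq_poly_mat[OF spectrum_ne] by blast
  have "\<exists>f. \<forall>i<n. \<forall>j<n. of_nat (card {l. l < n \<and> dd i l = s \<and> dd j l = 1}) = (f (dd i j) :: complex)" for s
  proof -
    obtain p where p: "\<And>i j. i < n \<Longrightarrow> j < n \<Longrightarrow> poly_mat p A $$ (i, j) = (if dd i j = s then 1 else 0)"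
      using distance_mat_poly by blast
    obtain f where f: "\<And>i j. i < n \<Longrightarrow> j < n \<Longrightarrow> poly_mat (p * u) A $$ (i, j) = f (dd i j)"
      using distance_constant_poly unfolding distance_constant_def by blast
    have "of_nat (card {l. l < n \<and> dd i l = s \<and> dd j l = 1}) = f (dd i j)" if ij: "i < n" "j < n" for i j
    proof -
      have "f (dd i j) = (\<Sum>l<n. poly_mat p A $$ (i, l) * T $$ (l, j))"
        unfolding f[OF ij, symmetric] poly_mat_mult u using ij by (intro mult_index) auto
      also have "\<dots> = (\<Sum>l<n. if dd i l = s \<and> dd j l = 1 then 1 else 0)"
        using ij by (intro sum.cong) (auto simp: p A_index)
      also have "\<dots> = of_nat (card {l. l < n \<and> dd i l = s \<and> dd j l = 1})"
        by (simp add: sum.If_cases Int_def)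
      finally show ?thesis by simp
    qed
    then show ?thesis by blast
  qed
  then have "\<exists>F. \<forall>s. \<forall>i<n. \<forall>j<n.
      of_nat (card {l. l < n \<and> dd i l = s \<and> dd j l = 1}) = (F s (dd i j) :: complex)"
    by (intro choice allI)
  then obtain F where F: "\<And>s i j. i < n \<Longrightarrow> j < n \<Longrightarrow>
      of_nat (card {l. l < n \<and> dd i l = s \<and> dd j l = 1}) = (F s (dd i j) :: complex)"
    by blast
  \<comment> \<open>\<open>F\<close> is complex-valued; the floor of the real part recovers the
    natural numbers that \<open>regular\<close> demands.\<close>
  have card_eq: "card {l. l < n \<and> dd i l = s \<and> dd j l = 1} = nat \<lfloor>Re (F s (dd i j))\<rfloor>" if "i < n" "j < n" for s i j
    using arg_cong[OF F[OF that, of s, symmetric], of Re] by simp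
  show ?thesis
    unfolding regular_def
    by (intro exI[of _ "\<lambda>s k. nat \<lfloor>Re (F s k)\<rfloor>"] allI impI) (rule card_eq)
qed

end

lemma (in normal_distance_mat) excess_eq_iff_regular:
  "excess d = spectral_excess A d \<longleftrightarrow> regular"
proof
  assume "excess d = spectral_excess A d"
  then interpret extremal_distance_mat A n dd d by unfold_locales
  show regular by (rule regular)
qed (rule regular_imp_excess_eq)

subsection \<open>Walks in a strongly connected digraph\<close>

context wf_digraph
begin

lemma ddist_le: "awalk u p v \<Longrightarrow> ddist G u v \<le> length p"
  unfolding ddist_def by (rule Least_le) blast

lemma ddist_attained:
  assumes "u \<rightarrow>\<^sup>* v"
  obtains p where "awalk u p v" "length p = ddist G u v"
proof -
  have "\<exists>k p. awalk u p v \<and> length p = k"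
    using assms by (auto simp: reachable_awalk)
  then have "\<exists>p. awalk u p v \<and> length p = ddist G u v"
    unfolding ddist_def by (rule LeastI_ex)
  then show thesis using that by blast
qed

lemma ddist_eq_0_iff:
  assumes "u \<rightarrow>\<^sup>* v"
  shows "ddist G u v = 0 \<longleftrightarrow> u = v"
proof
  assume "ddist G u v = 0"
  then show "u = v" using ddist_attained[OF assms] by (metis awalk_empty_ends length_0_conv)
next
  assume "u = v"
  then have "awalk u [] v" using assms reachable_in_verts by (auto simp: awalk_Nil_iff)
  then show "ddist G u v = 0" using ddist_le[of u "[]" v] by simp
qed

lemma ddist_triangle:
  assumes "u \<rightarrow>\<^sup>* w" "w \<rightarrow>\<^sup>* v"
  shows "ddist G u v \<le> ddist G u w + ddist G w v"
proof -
  obtain p q where "awalk u p w" "length p = ddist G u w" "awalk w q v" "length q = ddist G w v"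
    using assms ddist_attained by metis
  then show ?thesis using ddist_le[OF awalk_appendI, of u p w q v] by simp
qed

text \<open>A repeated vertex would allow a closed subwalk to be cut out, leaving a walk shorter
  than the distance.\<close>

lemma shortest_awalk_is_apath:
  assumes "awalk u p v" "length p = ddist G u v"
  shows "apath u p v"
proof (rule ccontr)
  assume "\<not> apath u p v"
  then have "\<not> distinct (awalk_verts u p)" using assms(1) by (simp add: apath_def)
  then obtain q r s w where p: "p = q @ r @ s" "r \<noteq> []" and w: "awalk u q w" "awalk w s v"
    using awalk_not_distinct_decomp[OF assms(1)] by auto
  have "ddist G u v \<le> length (q @ s)" using awalk_appendI[OF w] by (rule ddist_le)
  moreover have "length p = length (q @ s) + length r" "length r > 0" using p by simp_all
  ultimately show False using assms(2) by linarith
qed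

end

context digraph
begin

lemma ddist_eq_1_iff:
  assumes "u \<rightarrow>\<^sup>* v"
  shows "ddist G u v = 1 \<longleftrightarrow> u \<rightarrow>\<^bsub>G\<^esub> v"
proof
  assume "ddist G u v = 1"
  then obtain p where p: "awalk u p v" "length p = 1" using ddist_attained[OF assms] by metis
  then obtain e where "p = [e]" by (auto simp: length_Suc_conv)
  then show "u \<rightarrow>\<^bsub>G\<^esub> v" using p(1) by (auto simp: awalk_simps arcs_ends_conv)
next
  assume uv: "u \<rightarrow>\<^bsub>G\<^esub> v"
  then obtain e where "e \<in> arcs G" "tail G e = u" "head G e = v" by (auto simp: arcs_ends_conv)
  then have "awalk u [e] v" by (auto simp: awalk_simps)
  then have "ddist G u v \<le> 1" using ddist_le[of u "[e]" v] by simp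
  moreover have "ddist G u v \<noteq> 0" using ddist_eq_0_iff[OF assms] uv adj_not_same by auto
  ultimately show "ddist G u v = 1" by simp
qed

definition walks :: "nat \<Rightarrow> 'a \<Rightarrow> 'a \<Rightarrow> 'b list set" where
  "walks k u v = {p. awalk u p v \<and> length p = k}"

lemma finite_walks: "finite (walks k u v)"
proof (rule finite_subset)
  show "walks k u v \<subseteq> {p. set p \<subseteq> arcs G \<and> length p = k}" by (auto simp: walks_def)
qed (intro finite_lists_length_eq finite_arcs)

lemma walks_0: "walks 0 u v = (if u = v \<and> u \<in> verts G then {[]} else {})"
  by (auto simp: walks_def awalk_Nil_iff)

text \<open>Cut off the last arc; without parallel arcs it is determined by its tail. The recursion
  matches \<open>A ^\<^sub>m Suc k = A ^\<^sub>m k * A\<close>.\<close>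

lemma card_walks_Suc:
  assumes "v \<in> verts G"
  shows "card (walks (Suc k) u v) = (\<Sum>w\<in>verts G. if w \<rightarrow>\<^bsub>G\<^esub> v then card (walks k u w) else 0)"
proof -
  have "walks (Suc k) u v = (\<lambda>(e, p). p @ [e]) ` (SIGMA e : in_arcs G v. walks k u (tail G e))"
  proof (intro equalityI subsetI)
    fix p assume p: "p \<in> walks (Suc k) u v"
    then obtain q e where q: "p = q @ [e]" by (cases p rule: rev_cases) (auto simp: walks_def)
    then have "awalk u q (tail G e)" "e \<in> in_arcs G v" "length q = k"
      using p by (auto simp: walks_def awalk_simps)
    then show "p \<in> (\<lambda>(e, p). p @ [e]) ` (SIGMA e : in_arcs G v. walks k u (tail G e))"
      using q by (intro image_eqI[of _ _ "(e, q)"]) (auto simp: walks_def)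
  next
    fix p assume "p \<in> (\<lambda>(e, p). p @ [e]) ` (SIGMA e : in_arcs G v. walks k u (tail G e))"
    then obtain e q where "p = q @ [e]" "e \<in> in_arcs G v" "awalk u q (tail G e)" "length q = k"
      by (auto simp: walks_def)
    then show "p \<in> walks (Suc k) u v"
      using awalk_appendI[of u q "tail G e" "[e]" v] by (auto simp: walks_def awalk_simps)
  qed
  moreover have "inj_on (\<lambda>(e, p). p @ [e]) (SIGMA e : in_arcs G v. walks k u (tail G e))"
    by (auto simp: inj_on_def)
  ultimately have "card (walks (Suc k) u v) = card (SIGMA e : in_arcs G v. walks k u (tail G e))"
    by (simp add: card_image)
  also have "\<dots> = (\<Sum>e\<in>in_arcs G v. card (walks k u (tail G e)))"
    by (intro card_SigmaI) (auto simp: finite_walks)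
  also have "\<dots> = (\<Sum>w\<in>tail G ` in_arcs G v. card (walks k u w))"
    by (subst sum.reindex) (auto simp: inj_on_def arc_to_ends_def intro: no_multi_arcs)
  also have "tail G ` in_arcs G v = {w \<in> verts G. w \<rightarrow>\<^bsub>G\<^esub> v}"
    by (auto simp: arcs_ends_conv)
  also have "(\<Sum>w\<in>{w \<in> verts G. w \<rightarrow>\<^bsub>G\<^esub> v}. card (walks k u w)) = (\<Sum>w\<in>verts G. if w \<rightarrow>\<^bsub>G\<^esub> v then card (walks k u w) else 0)"
    by (simp add: sum.inter_filter)
  finally show ?thesis .
qed

text \<open>Walks of length \<open>k\<close> to a vertex at distance \<open>k\<close> are shortest,
  hence paths, so walks may be counted instead.\<close>

lemma num_paths_to_sphere_eq:
  "num_paths_to_sphere G k u = (\<Sum>v\<in>verts G. if ddist G u v = k then card (walks k u v) else 0)"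
proof -
  have "{p. length p = k \<and> (\<exists>v\<in>out_sphere G k u. apath u p v)} = (\<Union>v\<in>out_sphere G k u. walks k u v)"
    using shortest_awalk_is_apath by (auto simp: walks_def out_sphere_def apath_def)
  then have "num_paths_to_sphere G k u = card (\<Union>v\<in>out_sphere G k u. walks k u v)"
    by (simp add: num_paths_to_sphere_def)
  also have "\<dots> = (\<Sum>v\<in>out_sphere G k u. card (walks k u v))"
  proof (rule card_UN_disjoint)
    show "\<forall>v\<in>out_sphere G k u. \<forall>w\<in>out_sphere G k u. v \<noteq> w \<longrightarrow> walks k u v \<inter> walks k u w = {}"
      by (auto simp: walks_def)
  qed (auto simp: finite_walks out_sphere_def)
  also have "\<dots> = (\<Sum>v\<in>verts G. if ddist G u v = k then card (walks k u v) else 0)"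
    by (simp add: out_sphere_def sum.inter_filter)
  finally show ?thesis .
qed

end

subsection \<open>Transfer to the adjacency matrix\<close>

locale enumerated_digraph = digraph +
  fixes vs :: "'a list"
  assumes strongly_connected: "strongly_connected G"
    and distinct_vs: "distinct vs"
    and set_vs: "set vs = verts G"
begin

definition "n = length vs"
definition "dd i j = ddist G (vs ! i) (vs ! j)"

lemma vs_verts [simp]: "i < n \<Longrightarrow> vs ! i \<in> verts G"
  unfolding set_vs[symmetric] n_def by simp

lemma n_eq_card: "n = card (verts G)"
  unfolding n_def set_vs[symmetric] using distinct_card[OF distinct_vs] by simp

lemma bij_vs: "bij_betw ((!) vs) {..<n} (verts G)"
  unfolding n_def set_vs[symmetric] using bij_betw_nth[OF distinct_vs] by simp

lemma sum_verts: "(\<Sum>v\<in>verts G. f v) = (\<Sum>i<n. f (vs ! i))"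
  using sum.reindex_bij_betw[OF bij_vs, of f] by simp

lemma reach [simp]: "i < n \<Longrightarrow> j < n \<Longrightarrow> vs ! i \<rightarrow>\<^sup>* vs ! j"
  using strongly_connected by (auto simp: strongly_connected_def)

abbreviation "AM \<equiv> adjacency_mat G vs"

lemma AM_carrier: "AM \<in> carrier_mat n n"
  by (simp add: adjacency_mat_def n_def)

lemma AM_pow:
  assumes "i < n" "j < n"
  shows "(AM ^\<^sub>m k) $$ (i, j) = of_nat (card (walks k (vs ! i) (vs ! j)))"
  using assms
proof (induction k arbitrary: j)
  case 0
  then have "vs ! i = vs ! j \<longleftrightarrow> i = j" using distinct_vs by (simp add: nth_eq_iff_index_eq n_def)
  then show ?case using 0 AM_carrier by (simp add: walks_0)
next
  case (Suc k)
  interpret square_mat AM n by unfold_locales (rule AM_carrier)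
  have "(AM ^\<^sub>m Suc k) $$ (i, j) = (\<Sum>l<n. (AM ^\<^sub>m k) $$ (i, l) * AM $$ (l, j))"
    by (rule pow_Suc_index[OF Suc.prems])
  also have "\<dots> = (\<Sum>l<n. of_nat (if vs ! l \<rightarrow>\<^bsub>G\<^esub> vs ! j then card (walks k (vs ! i) (vs ! l)) else 0))"
    using Suc by (intro sum.cong) (auto simp: adjacency_mat_def n_def)
  also have "\<dots> = of_nat (card (walks (Suc k) (vs ! i) (vs ! j)))"
    using Suc.prems by (simp add: card_walks_Suc sum_verts)
  finally show ?case .
qed

sublocale distance_mat AM n dd
proof
  show "AM \<in> carrier_mat n n" by (rule AM_carrier)
  show "0 < n"
    using strongly_connected by (auto simp: n_eq_card card_gt_0_iff strongly_connected_def)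
  fix i j assume ij: "i < n" "j < n"
  show "AM $$ (i, j) = (if dd i j = 1 then 1 else 0)"
    using ij ddist_eq_1_iff[OF reach[OF ij]] by (simp add: adjacency_mat_def n_def dd_def)
  show "dd i j = 0 \<longleftrightarrow> i = j"
    using ij ddist_eq_0_iff[OF reach[OF ij]] distinct_vs
    by (simp add: dd_def nth_eq_iff_index_eq n_def)
  show "dd i j \<le> dd i l + dd l j" if "l < n" for l
    using ddist_triangle ij that by (simp add: dd_def)
  show "(AM ^\<^sub>m k) $$ (i, j) = 0" if "k < dd i j" for k
  proof -
    have "walks k (vs ! i) (vs ! j) = {}"
      using that ddist_le by (force simp: walks_def dd_def)
    then show ?thesis by (simp add: AM_pow[OF ij])
  qed
  have "walks (dd i j) (vs ! i) (vs ! j) \<noteq> {}"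
    using ddist_attained[OF reach[OF ij]] by (auto simp: walks_def dd_def)
  then show "\<exists>c::nat. c > 0 \<and> (AM ^\<^sub>m dd i j) $$ (i, j) = of_nat c"
    using finite_walks by (auto simp: AM_pow[OF ij] card_gt_0_iff)
qed

lemma ddist_le_diam: "u \<in> verts G \<Longrightarrow> v \<in> verts G \<Longrightarrow> ddist G u v \<le> diam G"
proof -
  assume uv: "u \<in> verts G" "v \<in> verts G"
  have "{ddist G u v | u v. u \<in> verts G \<and> v \<in> verts G} = (\<lambda>(u, v). ddist G u v) ` (verts G \<times> verts G)"
    by auto
  then have "finite {ddist G u v | u v. u \<in> verts G \<and> v \<in> verts G}" by simp
  then show ?thesis unfolding diam_def using uv by (intro Max_ge) auto
qed

lemma simple_excess_eq: "simple_excess G k = excess k"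
proof -
  have "mean_paths G k = total_walks k / n"
  proof -
    have "(\<Sum>v\<in>verts G. real (num_paths_to_sphere G k v)) = total_walks k"
      unfolding sum_verts total_walks_def num_paths_to_sphere_eq of_nat_sum
      by (intro sum.cong refl) (simp add: dd_def AM_pow)
    then show ?thesis by (simp add: mean_paths_def n_eq_card)
  qed
  moreover have "mean_sphere G k = total_pairs k / n"
  proof -
    have "real (card (out_sphere G k v)) = (\<Sum>w\<in>verts G. if ddist G v w = k then 1 else 0)" for v
      by (simp add: out_sphere_def sum.If_cases Int_def)
    then have "(\<Sum>v\<in>verts G. real (card (out_sphere G k v))) = total_pairs k"
      by (simp only: sum_verts total_pairs_def dd_def)
    then show ?thesis by (simp add: mean_sphere_def n_eq_card)
  qed
  \<comment> \<open>Beyond the diameter \<open>simple_excess\<close> is 0 by definition and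
    \<open>excess\<close> by division by zero.\<close>
  moreover have "total_pairs k = 0" if "\<not> k \<le> diam G"
  proof -
    have "dd i j \<noteq> k" if "i < n" "j < n" for i j
      using that \<open>\<not> k \<le> diam G\<close> ddist_le_diam[of "vs ! i" "vs ! j"] by (auto simp: dd_def)
    then show ?thesis by (simp add: total_pairs_def)
  qed
  ultimately show ?thesis by (simp add: simple_excess_def excess_def)
qed

lemma distance_regular_iff: "distance_regular G \<longleftrightarrow> regular"
proof -
  have card: "card (out_sphere G s (vs ! i) \<inter> out_sphere G 1 (vs ! j)) = card {l. l < n \<and> dd i l = s \<and> dd j l = 1}"
    for s i j
  proof -
    have "out_sphere G s (vs ! i) \<inter> out_sphere G 1 (vs ! j) = (!) vs ` {l. l < n \<and> dd i l = s \<and> dd j l = 1}"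
      using bij_vs by (auto simp: out_sphere_def dd_def bij_betw_def)
    moreover have "inj_on ((!) vs) {l. l < n \<and> dd i l = s \<and> dd j l = 1}"
      using bij_vs by (rule inj_on_subset[OF bij_betw_imp_inj_on]) auto
    ultimately show ?thesis by (simp add: card_image)
  qed
  have range: "k \<in> {1..diam G} \<longleftrightarrow> k \<noteq> 0" if "dd i j = k" "i < n" "j < n" for i j k
    using that ddist_le_diam[of "vs ! i" "vs ! j"] by (auto simp: dd_def)
  have verts: "(\<forall>v\<in>verts G. P v) \<longleftrightarrow> (\<forall>i<n. P (vs ! i))" for P
    using bij_betw_imp_surj_on[OF bij_vs] by (metis imageE image_eqI lessThan_iff)
  have "distance_regular G \<longleftrightarrow> (\<exists>a :: nat \<Rightarrow> nat \<Rightarrow> nat. \<forall>k\<in>{1..diam G}. \<forall>i<n. \<forall>j<n. dd i j = k \<longrightarrow>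
        (\<forall>s\<le>k + 1. card {l. l < n \<and> dd i l = s \<and> dd j l = 1} = a s k))"
    unfolding distance_regular_def verts dd_def[symmetric] card ..
  also have "\<dots> \<longleftrightarrow> regular"
    unfolding regular_def using range by (intro ex_cong1) blast
  finally show ?thesis .
qed

end

theorem mainTheorem7:
  fixes G :: "('a, 'b) pre_digraph" and vs :: "'a list" and d :: nat
  assumes "digraph G"
    and "strongly_connected G"
    and "distinct vs" and "set vs = verts G"
    and "card (spectrum (adjacency_mat G vs)) = d + 1"
  shows "simple_excess G d \<le> spectral_excess (adjacency_mat G vs) d \<and>
         (normal_mat (adjacency_mat G vs) \<longrightarrow>
           (simple_excess G d = spectral_excess (adjacency_mat G vs) d \<longleftrightarrow> distance_regular G))"
proof -
  interpret digraph G by (rule assms(1))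
  interpret enumerated_digraph G vs
    using assms(2-4) by unfold_locales
  show ?thesis
  proof (intro conjI impI)
    show "simple_excess G d \<le> spectral_excess AM d"
      unfolding simple_excess_eq by (rule excess_le_spectral_excess)
    assume "normal_mat AM"
    then interpret normal_distance_mat AM n dd d
      using assms(5) by unfold_locales simp_all
    show "simple_excess G d = spectral_excess AM d \<longleftrightarrow> distance_regular G"
      unfolding simple_excess_eq distance_regular_iff by (rule excess_eq_iff_regular)
  qed
qed

end
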